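(* Let $d\ge 2$. Set $c = 2^{\frac{1}{5(4d+1)}}>1$ and $K = 20(4d+1)\frac{\log(4d)}{\log 2}$. Let $\alpha>0$, $\beta\in(0,1]$ and $\eta\in(0,\beta)$ satisfy $\delta := \beta-\eta-\alpha>0$. Let $n$ be an odd positive integer and let $\ell\in\mathbb{N}$ with $\ell\le n$. If $n\ge K^{1/\delta}$ and $$\mathsf{P}_{n+1}\Big(\Gamma_{[0,\ell]}\in \mathsf{CS}^{\alpha,\ell,n}_{\beta,\eta}\Big)\ \ge\ c^{-n^{\delta}/2},$$ then $$\mathsf{W}_n\big(\Gamma\text{ closes}\big)\ \le\ 2(n+1)\,c^{-n^{\delta}/2}.$$
   Context: $\mathbb{N}=\{0,1,2,\dots\}$; for integers $i\le j$, $[i,j]=\{i,\dots,j\}$. Walks. A walk of length $n$ is a map $\gamma:[0,n]\to\mathbb{Z}^d$ with consecutive values at Euclidean distance $1$; all walks considered are self-avoiding (injective). A walk of length $0$ is a single vertex. Write $\gamma_j=\gamma(j)$, let $\gamma_{[i,j]}$ be the restriction to $[i,j]$, and let $|\gamma|$ be the length. $\mathrm{SAW}_n$ is the set of self-avoiding walks of length $n$ with $\gamma_0=0$; $\mathsf{W}_n$ is the uniform law on it. A walk of length $n$ closes if $\|\gamma_n-\gamma_0\|=1$. The random element under any of the laws is denoted $\Gamma$. Lexicographic order. Vertices of $\mathbb{Z}^d$ are ordered lexicographically (when $d=2$, with the second coordinate compared before the first). $\mathrm{NE}(V)$ is the lexicographically maximal vertex of a finite set $V$; $\mathrm{NE}(\gamma)$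 is that of the image of $\gamma$. $\mathrm{SAW}^0_n$ is the set of self-avoiding walks of length $n$ with $\mathrm{NE}(\gamma)=0$ (starting point free); $\mathsf{W}^0_n$ is the uniform law on $\mathrm{SAW}^0_n$. Two-part decomposition. Given a self-avoiding walk $\gamma$ of length $n$ with $\gamma_j=\mathrm{NE}(\gamma)$, consider the two walks emanating from $\mathrm{NE}(\gamma)$ with vertex lists $(\gamma_j,\gamma_{j-1},\dots,\gamma_0)$ and $(\gamma_j,\gamma_{j+1},\dots,\gamma_n)$. The first part $\gamma^1$ is the one whose list is lexicographically larger (a proper prefix being smaller), the second part $\gamma^2$ is the other one, and we write $\gamma=[\gamma^1,\gamma^2]$. First parts. $\mathrm{First}_\ell\subseteq\mathrm{SAW}_\ell$ is the set of walks $\gamma$ of length $\ell$ with $\gamma_0=0=\mathrm{NE}(\gamma)$. For $\ell\le n$, $\mathrm{First}_{\ell,n}$ is the set of $\gamma\in\mathrm{First}_\ell$ for which there is $\phi\in\mathrm{SAW}_{n-\ell}$ such that $[\gamma,\phi]$ is the two-part decomposition of some element of $\mathrm{SAW}^0_n$. Charming. Let $\alpha>0$, $n$ odd, $\ell\in[0,n]$, $\gamma\in\mathrm{First}_{\ell,n}$, and $k\in[0,\ell]$ with $\ell-k$ even. Then $\gamma$ is $(\alpha,n,\ell)$-charming at index $k$ if $$\mathsf{W}^0_{k+n-\ell}\big(\Gamma\text{ closes}\,\big|\,\Gamma^1=\gamma_{[0,k]}\big)>n^{-\alpha}$$ (the condition is regarded as failing if the conditioning event is empty). $\mathsf{CS}^{\alpha,\ell,n}_{\beta,\eta}$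 is the set of $\gamma\in\mathrm{First}_{\ell,n}$ that are $(\alpha,n,\ell)$-charming for at least $n^{\beta-\eta}/4$ indices belonging to the interval $[\ell-n^\beta,\ell]$. Polygons. For $m\ge4$ even, a (self-avoiding) polygon of length $m$ is the set of $m$ edges consisting of the $m-1$ edges of a closing self-avoiding walk of length $m-1$ together with the edge joining its endpoints. $\mathrm{SAP}_m$ is the set of polygons of length $m$ whose lexicographically maximal vertex is $0$, and $\mathsf{P}_m$ is the uniform law on $\mathrm{SAP}_m$. A polygon $\phi\in\mathrm{SAP}_m$ is regarded as a map $\phi:[0,m]\to\mathbb{Z}^d$ tracing its vertices, with $\phi_0=\phi_m=0$ and $\phi_1$ the lexicographically larger of the two neighbours of $0$ in $\phi$ (when $d=2$, $\phi_1=-e_1$ and $\phi_{m-1}=-e_2$); $\phi_{[0,\ell]}$ denotes restriction. *)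

theory Defs
  imports "HOL-Probability.Probability"
begin

text \<open>
  The lattice of dimension \<open>d\<close> is the type \<open>int ^ 'd\<close> with \<open>CARD('d) = d\<close>; the coordinates are
  indexed by a finite linearly ordered type, so that vertices can be compared lexicographically.
  A walk of length \<open>n\<close>, a map from \<open>{0..n}\<close> to the lattice, is encoded by the list of its
  \<open>n + 1\<close> values. Hence the restriction of \<open>\<gamma>\<close> to \<open>{0..k}\<close> is \<open>take (Suc k) \<gamma>\<close>.
\<close>

type_synonym 'd vertex = "(int, 'd) vec"

definition to_real :: "'d::finite vertex \<Rightarrow> real ^ 'd" where
  "to_real x = (\<chi> i. real_of_int (x $ i))"

definition adjacent :: "'d::finite vertex \<Rightarrow> 'd vertex \<Rightarrow> bool" where
  "adjacent x y \<longleftrightarrow> dist (to_real x) (to_real y) = 1"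


section \<open>Lexicographic order\<close>

text \<open>\<open>coord_before j i\<close>: coordinate \<open>j\<close> is compared before coordinate \<open>i\<close>.
  In dimension two the second coordinate comes first.\<close>

definition coord_before :: "'d::{finite,linorder} \<Rightarrow> 'd \<Rightarrow> bool" where
  "coord_before j i \<longleftrightarrow> (if CARD('d) = 2 then i < j else j < i)"

definition vertex_less :: "('d::{finite,linorder} vertex \<times> 'd vertex) set" where
  "vertex_less = {(x, y). \<exists>i. x $ i < y $ i \<and> (\<forall>j. coord_before j i \<longrightarrow> x $ j = y $ j)}"

definition NE :: "'d::{finite,linorder} vertex set \<Rightarrow> 'd vertex" where
  "NE V = (THE v. v \<in> V \<and> (\<forall>w\<in>V. w \<noteq> v \<longrightarrow> (w, v) \<in> vertex_less))"


section \<open>Self-avoiding walks\<close>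

definition self_avoiding_walk :: "nat \<Rightarrow> 'd::finite vertex list \<Rightarrow> bool" where
  "self_avoiding_walk n \<gamma> \<longleftrightarrow>
     length \<gamma> = Suc n \<and> (\<forall>i<n. adjacent (\<gamma> ! i) (\<gamma> ! Suc i)) \<and> distinct \<gamma>"

definition SAW :: "nat \<Rightarrow> 'd::finite vertex list set" where
  "SAW n = {\<gamma>. self_avoiding_walk n \<gamma> \<and> hd \<gamma> = 0}"

definition W :: "nat \<Rightarrow> 'd::finite vertex list pmf" where
  "W n = pmf_of_set (SAW n)"

definition closes :: "'d::finite vertex list \<Rightarrow> bool" where
  "closes \<gamma> \<longleftrightarrow> adjacent (last \<gamma>) (hd \<gamma>)"

definition SAW0 :: "nat \<Rightarrow> 'd::{finite,linorder} vertex list set" where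
  "SAW0 n = {\<gamma>. self_avoiding_walk n \<gamma> \<and> NE (set \<gamma>) = 0}"

definition W0 :: "nat \<Rightarrow> 'd::{finite,linorder} vertex list pmf" where
  "W0 n = pmf_of_set (SAW0 n)"


section \<open>Two-part decomposition and first parts\<close>

text \<open>A proper prefix is smaller in \<^const>\<open>lexord\<close>. The two lists compared below share only
  their first entry, so they coincide only for a walk of length zero.\<close>

definition two_part :: "'d::{finite,linorder} vertex list \<Rightarrow> 'd vertex list \<times> 'd vertex list" where
  "two_part \<gamma> =
     (let j = (THE j. j < length \<gamma> \<and> \<gamma> ! j = NE (set \<gamma>));
          backward = rev (take (Suc j) \<gamma>);
          forward = drop j \<gamma>
      in if (backward, forward) \<in> lexord vertex_less then (forward, backward)
         else (backward, forward))"

definition first_part :: "'d::{finite,linorder} vertex list \<Rightarrow> 'd vertex list" where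
  "first_part \<gamma> = fst (two_part \<gamma>)"

definition First :: "nat \<Rightarrow> 'd::{finite,linorder} vertex list set" where
  "First l = {\<gamma> \<in> SAW l. NE (set \<gamma>) = 0}"

definition First_in :: "nat \<Rightarrow> nat \<Rightarrow> 'd::{finite,linorder} vertex list set" where
  "First_in l n = {\<gamma> \<in> First l. \<exists>\<phi>\<in>SAW (n - l). \<exists>\<psi>\<in>SAW0 n. two_part \<psi> = (\<gamma>, \<phi>)}"


section \<open>Charming indices\<close>

text \<open>If the conditioning event is null, then \<^const>\<open>cond_prob\<close> is \<open>0\<close> and the strict inequality
  fails.\<close>

definition charming :: "real \<Rightarrow> nat \<Rightarrow> nat \<Rightarrow> 'd::{finite,linorder} vertex list \<Rightarrow> nat \<Rightarrow> bool" where
  "charming \<alpha> n l \<gamma> k \<longleftrightarrow>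
     k \<le> l \<and> even (l - k) \<and>
     cond_prob (measure_pmf (W0 (k + (n - l)))) closes (\<lambda>\<Gamma>. first_part \<Gamma> = take (Suc k) \<gamma>)
       > real n powr (- \<alpha>)"

definition CS :: "real \<Rightarrow> nat \<Rightarrow> nat \<Rightarrow> real \<Rightarrow> real \<Rightarrow> 'd::{finite,linorder} vertex list set" where
  "CS \<alpha> l n \<beta> \<eta> =
     {\<gamma> \<in> First_in l n.
        real (card {k. real l - real n powr \<beta> \<le> real k \<and> k \<le> l \<and> charming \<alpha> n l \<gamma> k})
          \<ge> real n powr (\<beta> - \<eta>) / 4}"


section \<open>Self-avoiding polygons\<close>

definition walk_edges :: "'d::finite vertex list \<Rightarrow> 'd vertex set set" where
  "walk_edges \<gamma> = {{\<gamma> ! i, \<gamma> ! Suc i} | i. Suc i < length \<gamma>}"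

definition polygon :: "nat \<Rightarrow> 'd::finite vertex set set \<Rightarrow> bool" where
  "polygon m P \<longleftrightarrow> 4 \<le> m \<and> even m \<and>
     (\<exists>\<gamma>. self_avoiding_walk (m - 1) \<gamma> \<and> closes \<gamma> \<and>
          P = insert {last \<gamma>, hd \<gamma>} (walk_edges \<gamma>))"

definition SAP :: "nat \<Rightarrow> 'd::{finite,linorder} vertex set set set" where
  "SAP m = {P. polygon m P \<and> NE (\<Union>P) = 0}"

definition Pol :: "nat \<Rightarrow> 'd::{finite,linorder} vertex set set pmf" where
  "Pol m = pmf_of_set (SAP m)"

text \<open>The map \<open>{0..m} \<rightarrow> \<int>\<^sup>d\<close> tracing a polygon of length \<open>m\<close> with maximal vertex \<open>0\<close>: of the two
  closed tours based at \<open>0\<close>, the one that starts towards the larger neighbour of \<open>0\<close>.\<close>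

definition tour :: "nat \<Rightarrow> 'd::{finite,linorder} vertex set set \<Rightarrow> 'd vertex list" where
  "tour m P = (THE \<phi>. length \<phi> = Suc m \<and> distinct (butlast \<phi>) \<and> walk_edges \<phi> = P \<and>
     \<phi> ! 0 = 0 \<and> \<phi> ! m = 0 \<and> \<phi> ! 1 = NE {v. {0, v} \<in> P})"

end

theory Submission
  imports Defs
begin

text \<open>
  Fix a first part \<open>\<gamma>\<close> of length \<open>l\<close> and let \<open>A k\<close> be the set of second parts of length \<open>n - l\<close>
  that are compatible with \<open>\<gamma>\<close> restricted to \<open>{0..k}\<close>. These sets decrease in \<open>k\<close>. At a charming
  index \<open>k\<close>, a proportion of more than \<open>n powr - \<alpha>\<close> of \<open>A k\<close> ends next to \<open>\<gamma> ! k\<close>; but an endpoint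
  has only \<open>2 * d\<close> neighbours, so each second part is counted for at most \<open>2 * d\<close> indices. Hence the
  cardinality of \<open>A k\<close> halves whenever \<open>k\<close> passes \<open>4 * d * n powr \<alpha>\<close> charming indices, and if \<open>\<gamma>\<close> has
  at least \<open>n powr (\<beta> - \<eta>) / 4\<close> of them, then \<open>A l\<close> is smaller by the factor \<open>c powr - (n powr \<delta>)\<close>
  than the set of all walks of length \<open>n - l\<close> from their maximal vertex. Reflecting such a walk
  through the origin makes it avoid \<open>\<gamma>\<close>, so the pairs of a first part and an arbitrary such walk
  number at most \<open>card (SAW n)\<close>. Therefore the polygons with charming initial segment number at most
  \<open>c powr - (n powr \<delta>) * card (SAW n)\<close>, while by hypothesis they make up a proportion of at least
  \<open>c powr - (n powr \<delta> / 2)\<close> of all polygons; and each polygon accounts for \<open>2 * (n + 1)\<close> closing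
  walks.
\<close>

section \<open>The lattice and its lexicographic order\<close>

text \<open>The square root of an integer equals 1 only if the integer does, so the Euclidean
  condition reduces to integer arithmetic on coordinates.\<close>

lemma adjacent_iff_sum: "adjacent x y \<longleftrightarrow> (\<Sum>i\<in>UNIV. (x $ i - y $ i)^2) = 1"
  for x y :: "'d::finite vertex"
proof -
  have "dist (to_real x) (to_real y) = sqrt (real_of_int (\<Sum>i\<in>UNIV. (x $ i - y $ i)^2))"
    by (simp add: dist_vec_def L2_set_def to_real_def dist_real_def)
  then show ?thesis
    unfolding adjacent_def by (simp only: real_sqrt_eq_1_iff of_int_eq_1_iff)
qed

lemma adjacent_sym: "adjacent x y \<longleftrightarrow> adjacent y x"
  unfolding adjacent_def by (simp add: dist_commute)

lemma adjacent_diff [simp]: "adjacent (x - a) (y - a) \<longleftrightarrow> adjacent x y"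
  by (simp add: adjacent_iff_sum)

lemma adjacent_uminus [simp]: "adjacent (- x) (- y) \<longleftrightarrow> adjacent x y"
  by (simp add: adjacent_iff_sum power2_commute)

lemma adjacent_axis: "adjacent x (x + axis i 1)"
  by (simp add: adjacent_iff_sum axis_def if_distrib[of "\<lambda>t. t^2"] cong: if_cong)

text \<open>Squares of integers that sum to 1 are all 0 except for one, which is 1; hence a step
  changes a single coordinate, by 1 or -1.\<close>

lemma adjacentD:
  fixes x y :: "'d::finite vertex"
  assumes "adjacent x y"
  shows "\<exists>i. \<exists>s\<in>{1, -1}. y = x + axis i s"
proof -
  define t where "t i = y $ i - x $ i" for i
  have sum: "(\<Sum>i\<in>UNIV. (t i)^2) = 1"
    using assms unfolding adjacent_iff_sum t_def by (simp add: power2_commute)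
  then obtain i where i: "t i \<noteq> 0"
    by fastforce
  have "(\<Sum>j\<in>UNIV. (t j)^2) = (t i)^2 + (\<Sum>j\<in>UNIV - {i}. (t j)^2)"
    by (simp add: sum.remove)
  moreover have "(t i)^2 \<ge> 1"
    using i by (simp add: int_one_le_iff_zero_less)
  moreover have nn: "(\<Sum>j\<in>UNIV - {i}. (t j)^2) \<ge> 0"
    by (simp add: sum_nonneg)
  ultimately have ti: "(t i)^2 = 1" and z: "(\<Sum>j\<in>UNIV - {i}. (t j)^2) = 0"
    using sum by linarith+
  have "t j = 0" if "j \<noteq> i" for j
    using z that by (subst (asm) sum_nonneg_eq_0_iff) auto
  then have "y = x + axis i (t i)"
    unfolding vec_eq_iff axis_def t_def by simp
  then show ?thesis
    using ti by (auto simp: power2_eq_1_iff)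
qed

lemma neighbours_subset:
  "{y. adjacent x y} \<subseteq> (\<lambda>(i, s). x + axis i s) ` (UNIV \<times> {1, -1})"
  for x :: "'d::finite vertex"
proof
  fix y assume "y \<in> {y. adjacent x y}"
  then obtain i s where "s \<in> {1, -1}" "y = x + axis i s"
    using adjacentD by blast
  then show "y \<in> (\<lambda>(i, s). x + axis i s) ` (UNIV \<times> {1, -1})"
    by (intro image_eqI[of _ _ "(i, s)"]) auto
qed

lemma finite_neighbours [simp]: "finite {y. adjacent x y}"
  for x :: "'d::finite vertex"
  by (rule finite_subset[OF neighbours_subset]) auto

lemma card_neighbours_le: "card {y. adjacent x y} \<le> 2 * CARD('d)"
  for x :: "'d::finite vertex"
proof -
  have "card {y. adjacent x y} \<le> card ((\<lambda>(i, s). x + axis i s) ` (UNIV \<times> {1, -1 :: int}))"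
    by (rule card_mono[OF _ neighbours_subset]) auto
  also have "\<dots> \<le> card ((UNIV :: 'd set) \<times> {1, -1 :: int})"
    by (rule card_image_le) auto
  finally show ?thesis
    by (simp add: card_cartesian_product)
qed

section \<open>Lexicographic comparison and maximal vertices\<close>

lemma coord_before_trans: "coord_before i j \<Longrightarrow> coord_before j k \<Longrightarrow> coord_before i k"
  by (auto simp: coord_before_def split: if_splits)

lemma coord_before_total: "coord_before i j \<or> i = j \<or> coord_before j i"
  by (auto simp: coord_before_def split: if_splits)

text \<open>Applied to the set of coordinates in which two vertices differ, this yields the
  coordinate that decides their comparison.\<close>

lemma coord_before_min:
  fixes S :: "'d::{finite,linorder} set"
  assumes "S \<noteq> {}"
  obtains i where "i \<in> S" "\<And>j. coord_before j i \<Longrightarrow> j \<notin> S"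
proof (cases "CARD('d) = 2")
  case True
  \<comment> \<open>In dimension two the comparison order reverses the order of the index type, so
    the coordinate compared first is the maximum.\<close>
  have "j \<notin> S" if "coord_before j (Max S)" for j
    using that True Max_ge[OF finite, of j S] by (auto simp: coord_before_def not_less[symmetric])
  then show ?thesis
    using that Max_in[OF finite assms] by simp
next
  case False
  have "j \<notin> S" if "coord_before j (Min S)" for j
    using that False Min_le[OF finite, of j S] by (auto simp: coord_before_def not_less[symmetric])
  then show ?thesis
    using that Min_in[OF finite assms] by simp
qed

lemma vertex_less_irrefl [simp]: "(x, x) \<notin> vertex_less"
  by (simp add: vertex_less_def)

lemma vertex_less_trans:
  assumes "(x, y) \<in> vertex_less" "(y, z) \<in> vertex_less"
  shows "(x, z) \<in> vertex_less"
proof -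
  obtain i where i: "x $ i < y $ i" "\<And>k. coord_before k i \<Longrightarrow> x $ k = y $ k"
    using assms(1) by (auto simp: vertex_less_def)
  obtain j where j: "y $ j < z $ j" "\<And>k. coord_before k j \<Longrightarrow> y $ k = z $ k"
    using assms(2) by (auto simp: vertex_less_def)
  consider "coord_before i j" | "i = j" | "coord_before j i"
    using coord_before_total by blast
  then show ?thesis
  proof cases
    case 1
    then have "x $ i < z $ i \<and> (\<forall>k. coord_before k i \<longrightarrow> x $ k = z $ k)"
      using i j coord_before_trans[of _ i j] coord_before_trans[of _ j i] by auto
    then show ?thesis
      by (auto simp: vertex_less_def)
  next
    case 2
    then have "x $ i < z $ i \<and> (\<forall>k. coord_before k i \<longrightarrow> x $ k = z $ k)"
      using i j by auto
    then show ?thesis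
      by (auto simp: vertex_less_def)
  next
    case 3
    then have "x $ j < z $ j \<and> (\<forall>k. coord_before k j \<longrightarrow> x $ k = z $ k)"
      using i j coord_before_trans[of _ i j] coord_before_trans[of _ j i] by auto
    then show ?thesis
      by (auto simp: vertex_less_def)
  qed
qed

lemma vertex_less_asym: "(x, y) \<in> vertex_less \<Longrightarrow> (y, x) \<notin> vertex_less"
  using vertex_less_trans vertex_less_irrefl by blast

lemma vertex_less_total:
  assumes "x \<noteq> y"
  shows "(x, y) \<in> vertex_less \<or> (y, x) \<in> vertex_less"
proof -
  have "{i. x $ i \<noteq> y $ i} \<noteq> {}"
    using assms by (auto simp: vec_eq_iff)
  then obtain i where "x $ i \<noteq> y $ i" "\<And>j. coord_before j i \<Longrightarrow> x $ j = y $ j"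
    by (rule coord_before_min) auto
  then show ?thesis
    by (cases "x $ i < y $ i") (auto simp: vertex_less_def intro!: exI[of _ i])
qed

lemma vertex_less_diff [simp]: "(x - a, y - a) \<in> vertex_less \<longleftrightarrow> (x, y) \<in> vertex_less"
  by (simp add: vertex_less_def)

text \<open>Subtracting \<open>x\<close> carries the pair of 0 and \<open>x\<close> to that of
  \<open>- x\<close> and 0; thus reflection through the origin exchanges the vertices below and
  above 0.\<close>

lemma vertex_less_uminus [simp]: "(- x, 0) \<in> vertex_less \<longleftrightarrow> (0, x) \<in> vertex_less"
  using vertex_less_diff[of 0 x x] by simp

lemma NE_eqI:
  assumes "v \<in> V" "\<And>w. w \<in> V \<Longrightarrow> w \<noteq> v \<Longrightarrow> (w, v) \<in> vertex_less"
  shows "NE V = v"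
  unfolding NE_def
proof (rule the_equality)
  fix u assume "u \<in> V \<and> (\<forall>w\<in>V. w \<noteq> u \<longrightarrow> (w, u) \<in> vertex_less)"
  then have "u \<noteq> v \<Longrightarrow> (u, v) \<in> vertex_less" "u \<noteq> v \<Longrightarrow> (v, u) \<in> vertex_less"
    using assms by auto
  then show "u = v"
    using vertex_less_asym by blast
qed (use assms in auto)

lemma exists_vertex_max:
  assumes "finite V" "V \<noteq> {}"
  shows "\<exists>v\<in>V. \<forall>w\<in>V. w \<noteq> v \<longrightarrow> (w, v) \<in> vertex_less"
  using assms
proof (induction rule: finite_ne_induct)
  case (singleton x)
  then show ?case by simp
next
  case (insert x V)
  then obtain v where v: "v \<in> V" "\<And>w. w \<in> V \<Longrightarrow> w \<noteq> v \<Longrightarrow> (w, v) \<in> vertex_less"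
    by blast
  have "x \<noteq> v"
    using insert.hyps v by blast
  then consider "(x, v) \<in> vertex_less" | "(v, x) \<in> vertex_less"
    using vertex_less_total by blast
  then show ?case
  proof cases
    case 1
    then show ?thesis
      using v by (intro bexI[of _ v]) auto
  next
    case 2
    have "(w, x) \<in> vertex_less" if "w \<in> V" for w
      using v(2)[OF that] 2 vertex_less_trans[of w v x] by (cases "w = v") auto
    then show ?thesis
      by (intro bexI[of _ x]) auto
  qed
qed

lemma
  assumes "finite V" "V \<noteq> {}"
  shows NE_in: "NE V \<in> V"
    and NE_max: "w \<in> V \<Longrightarrow> w \<noteq> NE V \<Longrightarrow> (w, NE V) \<in> vertex_less"
proof -
  obtain v where v: "v \<in> V" "\<And>w. w \<in> V \<Longrightarrow> w \<noteq> v \<Longrightarrow> (w, v) \<in> vertex_less"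
    using exists_vertex_max[OF assms] by blast
  then have "NE V = v"
    by (rule NE_eqI)
  then show "NE V \<in> V" "w \<in> V \<Longrightarrow> w \<noteq> NE V \<Longrightarrow> (w, NE V) \<in> vertex_less"
    using v by auto
qed

lemma NE_eq_iff:
  assumes "finite V" "V \<noteq> {}"
  shows "NE V = v \<longleftrightarrow> v \<in> V \<and> (\<forall>w\<in>V. w \<noteq> v \<longrightarrow> (w, v) \<in> vertex_less)"
proof
  assume "NE V = v"
  then show "v \<in> V \<and> (\<forall>w\<in>V. w \<noteq> v \<longrightarrow> (w, v) \<in> vertex_less)"
    using NE_in[OF assms] NE_max[OF assms] by auto
next
  assume "v \<in> V \<and> (\<forall>w\<in>V. w \<noteq> v \<longrightarrow> (w, v) \<in> vertex_less)"
  then show "NE V = v"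
    by (intro NE_eqI) auto
qed

lemma NE_diff:
  assumes "finite V" "V \<noteq> {}"
  shows "NE ((\<lambda>x. x - a) ` V) = NE V - a"
  using NE_in[OF assms] NE_max[OF assms] by (intro NE_eqI) auto

section \<open>Self-avoiding walks\<close>

lemma self_avoiding_walk_iff:
  "self_avoiding_walk n \<gamma> \<longleftrightarrow> length \<gamma> = Suc n \<and> successively adjacent \<gamma> \<and> distinct \<gamma>"
  by (auto simp: self_avoiding_walk_def successively_conv_nth)

lemma self_avoiding_walk_not_Nil: "self_avoiding_walk n \<gamma> \<Longrightarrow> \<gamma> \<noteq> []"
  by (auto simp: self_avoiding_walk_iff)

lemma self_avoiding_walk_diff:
  "self_avoiding_walk n (map (\<lambda>x. x - a) \<gamma>) \<longleftrightarrow> self_avoiding_walk n \<gamma>"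
  by (simp add: self_avoiding_walk_iff successively_map distinct_map inj_on_def)

lemma self_avoiding_walk_uminus:
  "self_avoiding_walk n (map uminus \<gamma>) \<longleftrightarrow> self_avoiding_walk n \<gamma>"
  by (simp add: self_avoiding_walk_iff successively_map distinct_map inj_on_def)

lemma successively_adjacent_rev [simp]: "successively adjacent (rev \<gamma>) \<longleftrightarrow> successively adjacent \<gamma>"
  by (simp add: adjacent_sym)

lemma closes_diff [simp]: "\<gamma> \<noteq> [] \<Longrightarrow> closes (map (\<lambda>x. x - a) \<gamma>) \<longleftrightarrow> closes \<gamma>"
  by (simp add: closes_def hd_map last_map)

lemma closes_rev [simp]: "closes (rev \<gamma>) \<longleftrightarrow> closes \<gamma>"
  by (simp add: closes_def hd_rev last_rev adjacent_sym)

text \<open>The two parts of a walk both list the vertex at which it is split, hence the \<open>tl\<close>.\<close>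

lemma self_avoiding_walk_join:
  assumes "hd g = hd p" "g \<noteq> []" "p \<noteq> []" "length g + length p = n + 2"
  shows "self_avoiding_walk n (rev g @ tl p) \<longleftrightarrow>
    self_avoiding_walk (length g - 1) g \<and> self_avoiding_walk (length p - 1) p \<and>
    set g \<inter> set p = {hd g}"
proof -
  obtain x g' p' where "g = x # g'" "p = x # p'"
    using assms by (metis list.exhaust_sel)
  then show ?thesis
    using assms(4)
    by (auto simp: self_avoiding_walk_iff successively_append_iff successively_Cons last_rev
      adjacent_sym)
qed

lemma finite_SAW: "finite (SAW n :: 'd::finite vertex list set)"
proof -
  \<comment> \<open>The starting point is arbitrary and distinctness is dropped; removing the first
    vertex leaves a shorter walk of the same kind from one of its finitely many neighbours.\<close>
  have "finite {\<gamma> :: 'd vertex list. length \<gamma> = Suc n \<and> successively adjacent \<gamma> \<and> hd \<gamma> = x}" for x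
  proof (induction n arbitrary: x)
    case 0
    have "{\<gamma> :: 'd vertex list. length \<gamma> = Suc 0 \<and> successively adjacent \<gamma> \<and> hd \<gamma> = x} \<subseteq> {[x]}"
      by (auto simp: length_Suc_conv)
    then show ?case
      by (rule finite_subset) simp
  next
    case (Suc n)
    let ?F = "\<lambda>n x. {\<gamma> :: 'd vertex list. length \<gamma> = Suc n \<and> successively adjacent \<gamma> \<and> hd \<gamma> = x}"
    have "?F (Suc n) x \<subseteq> (#) x ` (\<Union>y\<in>{y. adjacent x y}. ?F n y)"
    proof
      fix \<gamma> assume "\<gamma> \<in> ?F (Suc n) x"
      then obtain y \<gamma>' where "\<gamma> = x # y # \<gamma>'" "length \<gamma>' = n" "adjacent x y"
          "successively adjacent (y # \<gamma>')"
        by (auto simp: length_Suc_conv)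
      then show "\<gamma> \<in> (#) x ` (\<Union>y\<in>{y. adjacent x y}. ?F n y)"
        by auto
    qed
    then show ?case
      by (rule finite_subset) (auto simp: Suc)
  qed
  then show ?thesis
    by (rule finite_subset[rotated]) (auto simp: SAW_def self_avoiding_walk_iff)
qed

lemma SAW_nonempty: "(SAW n :: 'd::finite vertex list set) \<noteq> {}"
proof -
  \<comment> \<open>The straight walk along one coordinate axis; \<open>undefined\<close> stands for
    an arbitrary coordinate.\<close>
  let ?\<gamma> = "map (\<lambda>k. axis undefined (int k)) [0..<Suc n] :: 'd vertex list"
  have step: "axis i (int (Suc k)) = (axis i (int k) :: 'd vertex) + axis i 1" for i k
    by (simp add: vec_eq_iff axis_def)
  have "?\<gamma> \<in> SAW n"
    unfolding SAW_def self_avoiding_walk_def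
    by (auto simp: step adjacent_axis distinct_map inj_on_def axis_eq_axis hd_map
        simp del: upt_Suc of_nat_Suc)
  then show ?thesis
    by blast
qed

lemma SAW0_iff:
  "\<gamma> \<in> SAW0 n \<longleftrightarrow> self_avoiding_walk n \<gamma> \<and> 0 \<in> set \<gamma> \<and> (\<forall>v\<in>set \<gamma>. v \<noteq> 0 \<longrightarrow> (v, 0) \<in> vertex_less)"
  unfolding SAW0_def using NE_eq_iff[of "set \<gamma>" 0] self_avoiding_walk_not_Nil[of n \<gamma>] by auto

lemma First_iff:
  "\<gamma> \<in> First n \<longleftrightarrow>
    self_avoiding_walk n \<gamma> \<and> hd \<gamma> = 0 \<and> (\<forall>v\<in>set \<gamma>. v \<noteq> 0 \<longrightarrow> (v, 0) \<in> vertex_less)"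
  unfolding First_def SAW_def
  using NE_eq_iff[of "set \<gamma>" 0] self_avoiding_walk_not_Nil[of n \<gamma>]
  by (cases \<gamma>) auto

lemma First_eq_Cons: "\<gamma> \<in> First n \<Longrightarrow> \<exists>xs. \<gamma> = 0 # xs \<and> length xs = n"
  by (cases \<gamma>) (auto simp: First_iff self_avoiding_walk_iff)

lemma finite_First: "finite (First n)"
  by (rule finite_subset[OF _ finite_SAW[of n]]) (auto simp: First_def)

text \<open>Translating the start to 0 gives a member of \<open>SAW n\<close>, and the vertex that
  was 0 tells how to undo this; only a walk and one of its vertices have to be chosen.\<close>

lemma finite_SAW0: "finite (SAW0 n :: 'd::{finite,linorder} vertex list set)"
proof (rule finite_subset)
  show "SAW0 n \<subseteq> (\<Union>\<sigma>\<in>SAW n. \<Union>v\<in>set \<sigma>. {map (\<lambda>x. x - v) \<sigma>} :: 'd vertex list set)"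
  proof
    fix \<gamma> :: "'d vertex list" assume "\<gamma> \<in> SAW0 n"
    then have \<gamma>: "self_avoiding_walk n \<gamma>" "0 \<in> set \<gamma>" "\<gamma> \<noteq> []"
      using self_avoiding_walk_not_Nil by (auto simp: SAW0_iff)
    let ?\<sigma> = "map (\<lambda>x. x - hd \<gamma>) \<gamma>"
    have "?\<sigma> \<in> SAW n"
      using \<gamma> by (simp add: SAW_def self_avoiding_walk_diff hd_map)
    moreover have "- hd \<gamma> \<in> set ?\<sigma>"
      using \<gamma> by (force simp: image_iff)
    moreover have "\<gamma> = map (\<lambda>x. x - (- hd \<gamma>)) ?\<sigma>"
      by (simp add: comp_def)
    ultimately show "\<gamma> \<in> (\<Union>\<sigma>\<in>SAW n. \<Union>v\<in>set \<sigma>. {map (\<lambda>x. x - v) \<sigma>})"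
      by blast
  qed
qed (auto simp: finite_SAW)

lemma SAW0_nonempty: "(SAW0 n :: 'd::{finite,linorder} vertex list set) \<noteq> {}"
proof -
  obtain \<gamma> :: "'d vertex list" where "\<gamma> \<in> SAW n"
    using SAW_nonempty by blast
  then have \<gamma>: "self_avoiding_walk n \<gamma>" "\<gamma> \<noteq> []"
    using self_avoiding_walk_not_Nil by (auto simp: SAW_def)
  then have "map (\<lambda>x. x - NE (set \<gamma>)) \<gamma> \<in> SAW0 n"
    by (simp add: SAW0_def self_avoiding_walk_diff NE_diff)
  then show ?thesis
    by blast
qed

text \<open>Reflecting the second walk through the origin puts it on the other side of the first,
  so that the pair forms a single self-avoiding walk.\<close>

lemma card_First_mult_le:
  assumes "l \<le> n"
  shows "card (First l :: 'd::{finite,linorder} vertex list set) *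
    card (First (n - l) :: 'd vertex list set) \<le> card (SAW n :: 'd vertex list set)"
proof -
  define J where "J = (\<lambda>(g, p). rev g @ tl (map uminus p) :: 'd vertex list)"
  define f where "f = (\<lambda>gp. map (\<lambda>x. x - hd (J gp)) (J gp))"
  have inj: "inj_on f (First l \<times> First (n - l))"
  proof (rule inj_on_inverseI)
    fix gp :: "'d vertex list \<times> 'd vertex list"
    assume "gp \<in> First l \<times> First (n - l)"
    then obtain g p where gp: "gp = (0 # g, 0 # p)" and [simp]: "length g = l" "length p = n - l"
      using First_eq_Cons[of "fst gp" l] First_eq_Cons[of "snd gp" "n - l"]
      by (cases gp) auto
    let ?h = "hd (J gp)"
    have J: "J gp = rev g @ 0 # map uminus p"
      by (simp add: J_def gp)
    have f: "f gp = map (\<lambda>x. x - ?h) (rev g) @ (- ?h) # map (\<lambda>x. x - ?h) (map uminus p)"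
      unfolding f_def by (subst (2) J) simp
    \<comment> \<open>The common starting vertex of the two walks sits at index \<open>l\<close> of
      the joined walk, so the translation can be read off there and undone.\<close>
    have "f gp ! l = - ?h"
      unfolding f by (simp add: nth_append)
    then have "map (\<lambda>x. x - f gp ! l) (f gp) = J gp"
      by (simp add: f_def comp_def)
    moreover have "gp = (rev (take (Suc l) (J gp)), map uminus (drop l (J gp)))"
      unfolding J by (simp add: gp comp_def)
    ultimately show "(\<lambda>\<omega>. (rev (take (Suc l) (map (\<lambda>x. x - \<omega> ! l) \<omega>)),
        map uminus (drop l (map (\<lambda>x. x - \<omega> ! l) \<omega>)))) (f gp) = gp"
      by simp
  qed
  have "f ` (First l \<times> First (n - l)) \<subseteq> SAW n"
  proof clarify
    fix g p :: "'d vertex list"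
    assume g: "g \<in> First l" and p: "p \<in> First (n - l)"
    then have ne: "g \<noteq> []" "p \<noteq> []"
      by (auto simp: First_iff self_avoiding_walk_iff)
    have "0 \<in> set g" "0 \<in> set p"
      using g p ne hd_in_set by (fastforce simp: First_iff)+
    \<comment> \<open>A common vertex other than 0 would lie below 0 as a vertex of \<open>g\<close>
      and above 0 as a reflected vertex of \<open>p\<close>.\<close>
    moreover have "v = 0" if "v \<in> set g" "- v \<in> set p" for v
    proof (rule ccontr)
      assume "v \<noteq> 0"
      then have "(v, 0) \<in> vertex_less" "(0, v) \<in> vertex_less"
        using g p that by (auto simp: First_iff)
      then show False
        using vertex_less_asym by blast
    qed
    ultimately have int: "set g \<inter> set (map uminus p) = {hd g}"
      using g by (force simp: First_iff)
    have len: "length g = Suc l" "length p = Suc (n - l)"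
      using g p by (auto simp: First_iff self_avoiding_walk_iff)
    have "self_avoiding_walk n (rev g @ tl (map uminus p))"
      using g p ne int len assms
      by (subst self_avoiding_walk_join) (auto simp: First_iff self_avoiding_walk_uminus hd_map)
    then have "self_avoiding_walk n (J (g, p))" "J (g, p) \<noteq> []"
      using ne by (simp_all add: J_def)
    then show "f (g, p) \<in> SAW n"
      by (simp add: f_def SAW_def self_avoiding_walk_diff hd_map)
  qed
  then have "card (First l \<times> First (n - l) :: ('d vertex list \<times> 'd vertex list) set) \<le>
      card (SAW n :: 'd vertex list set)"
    by (rule card_inj_on_le[OF inj _ finite_SAW])
  then show ?thesis
    by (simp add: card_cartesian_product)
qed

section \<open>Polygons\<close>

lemma walk_edges_single [simp]: "walk_edges [x] = {}"
  by (simp add: walk_edges_def)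

lemma walk_edges_altdef: "walk_edges \<gamma> = (\<lambda>i. {\<gamma> ! i, \<gamma> ! Suc i}) ` {..<length \<gamma> - 1}"
  by (auto simp: walk_edges_def)

lemma walk_edges_Cons [simp]: "walk_edges (x # y # zs) = insert {x, y} (walk_edges (y # zs))"
  unfolding walk_edges_altdef by (simp add: lessThan_Suc_eq_insert_0 image_image)

lemma walk_edges_snoc: "walk_edges (xs @ [y, z]) = insert {y, z} (walk_edges (xs @ [y]))"
proof (induction xs)
  case (Cons x xs)
  then show ?case
    by (cases xs) auto
qed simp

lemma walk_edges_rev [simp]: "walk_edges (rev xs) = walk_edges xs"
proof (induction xs rule: induct_list012)
  case (3 x y zs)
  then show ?case
    using walk_edges_snoc[of "rev zs" y x] by (simp add: insert_commute)
qed simp_all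

lemma Union_walk_edges: "\<Union>(walk_edges (x # y # zs)) = set (x # y # zs)"
  by (induction zs arbitrary: x y) auto

text \<open>Repeating the starting vertex at the end adds the closing edge, so a polygon becomes the
  edge set of a closed list.\<close>

definition cycle_edges :: "'d::finite vertex list \<Rightarrow> 'd vertex set set" where
  "cycle_edges \<gamma> = walk_edges (\<gamma> @ [hd \<gamma>])"

lemma cycle_edges_eq:
  assumes "\<gamma> \<noteq> []"
  shows "cycle_edges \<gamma> = insert {last \<gamma>, hd \<gamma>} (walk_edges \<gamma>)"
  using walk_edges_snoc[of "butlast \<gamma>" "last \<gamma>" "hd \<gamma>"] assms
  by (cases \<gamma> rule: rev_cases) (simp_all add: cycle_edges_def)

lemma cycle_edges_rotate [simp]: "cycle_edges (rotate i \<gamma>) = cycle_edges \<gamma>"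
proof (induction i)
  case (Suc i)
  have "cycle_edges (rotate1 \<gamma>) = cycle_edges \<gamma>" for \<gamma> :: "'a vertex list"
  proof (cases \<gamma> rule: remdups_adj.cases)
    case (3 x y zs)
    then show ?thesis
      using walk_edges_snoc[of "y # zs" x y] by (simp add: cycle_edges_def insert_commute)
  qed auto
  then show ?case
    using Suc by simp
qed simp

lemma Union_cycle_edges:
  assumes "\<gamma> \<noteq> []"
  shows "\<Union>(cycle_edges \<gamma>) = set \<gamma>"
proof (cases \<gamma> rule: remdups_adj.cases)
  case (3 x y zs)
  then show ?thesis
    using Union_walk_edges[of x y "zs @ [x]"] by (auto simp: cycle_edges_def)
qed (use assms in \<open>auto simp: cycle_edges_def\<close>)

lemma rotate_closing_walk:
  assumes "self_avoiding_walk n \<gamma>" "closes \<gamma>"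
  shows "self_avoiding_walk n (rotate i \<gamma>)" "closes (rotate i \<gamma>)"
proof -
  have step: "self_avoiding_walk n (rotate1 \<gamma>) \<and> closes (rotate1 \<gamma>)"
    if "self_avoiding_walk n \<gamma>" "closes \<gamma>" for \<gamma> :: "'a vertex list"
  proof (cases \<gamma> rule: remdups_adj.cases)
    case (3 x y zs)
    then show ?thesis
      using that successively_append_iff[of adjacent "y # zs" "[x]"]
      by (auto simp: self_avoiding_walk_iff closes_def)
  qed (use that in auto)
  have "self_avoiding_walk n (rotate i \<gamma>) \<and> closes (rotate i \<gamma>)"
    using assms by (induction i) (auto dest: step)
  then show "self_avoiding_walk n (rotate i \<gamma>)" "closes (rotate i \<gamma>)"
    by auto
qed

text \<open>Index \<open>m\<close> repeats index 0, so every vertex occurs once below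
  \<open>m\<close> and meets only the edges to its successor and its predecessor; the predecessor of
  index 0 has index \<open>m - 1\<close>.\<close>

lemma closed_walk_neighbour_iff:
  assumes "length \<rho> = Suc m" "distinct (butlast \<rho>)" "\<rho> ! m = \<rho> ! 0" "i < m"
  shows "{\<rho> ! i, w} \<in> walk_edges \<rho> \<longleftrightarrow> w = \<rho> ! Suc i \<or> w = \<rho> ! ((if i = 0 then m else i) - 1)"
proof
  have inj: "a = b" if "\<rho> ! a = \<rho> ! b" "a < m" "b < m" for a b
    using that assms nth_eq_iff_index_eq[of "butlast \<rho>" a b] by (simp add: nth_butlast)
  assume "{\<rho> ! i, w} \<in> walk_edges \<rho>"
  then obtain j where j: "j < m" "{\<rho> ! i, w} = {\<rho> ! j, \<rho> ! Suc j}"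
    using assms(1) by (auto simp: walk_edges_def)
  then consider "\<rho> ! i = \<rho> ! j" "w = \<rho> ! Suc j" | "\<rho> ! i = \<rho> ! Suc j" "w = \<rho> ! j"
    by (auto simp: doubleton_eq_iff)
  then show "w = \<rho> ! Suc i \<or> w = \<rho> ! ((if i = 0 then m else i) - 1)"
  proof cases
    case 1
    then show ?thesis
      using inj[of i j] j assms(4) by auto
  next
    case 2
    show ?thesis
    proof (cases "Suc j = m")
      case True
      then have "i = 0"
        using inj[of i 0] 2 assms(3,4) by auto
      then show ?thesis
        using 2 True by auto
    next
      case False
      then have "i = Suc j"
        using inj[of i "Suc j"] 2 j assms(4) by auto
      then show ?thesis
        using 2 by auto
    qed
  qed
next
  assume "w = \<rho> ! Suc i \<or> w = \<rho> ! ((if i = 0 then m else i) - 1)"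
  moreover have "{\<rho> ! i, \<rho> ! ((if i = 0 then m else i) - 1)} \<in> walk_edges \<rho>"
  proof (cases "i = 0")
    case True
    then show ?thesis
      using assms by (auto simp: walk_edges_def insert_commute intro!: exI[of _ "m - 1"])
  next
    case False
    then show ?thesis
      using assms by (auto simp: walk_edges_def insert_commute intro!: exI[of _ "i - 1"])
  qed
  moreover have "{\<rho> ! i, \<rho> ! Suc i} \<in> walk_edges \<rho>"
    using assms by (auto simp: walk_edges_def)
  ultimately show "{\<rho> ! i, w} \<in> walk_edges \<rho>"
    by auto
qed

text \<open>Each vertex has only two neighbours along the edges, one of which was just visited, so
  every vertex is forced once the first step is known.\<close>

lemma closed_walk_unique:
  assumes \<rho>: "length \<rho> = Suc m" "distinct (butlast \<rho>)" "\<rho> ! m = \<rho> ! 0"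
    and \<sigma>: "length \<sigma> = Suc m" "distinct (butlast \<sigma>)" "\<sigma> ! m = \<sigma> ! 0"
    and "walk_edges \<rho> = walk_edges \<sigma>" "\<rho> ! 0 = \<sigma> ! 0" "\<rho> ! 1 = \<sigma> ! 1" "3 \<le> m"
  shows "\<rho> = \<sigma>"
proof (rule nth_equalityI)
  have inj: "a = b" if "\<sigma> ! a = \<sigma> ! b" "a < m" "b < m" for a b
    using that \<sigma> nth_eq_iff_index_eq[of "butlast \<sigma>" a b] by (simp add: nth_butlast)
  fix i assume "i < length \<rho>"
  then have "i \<le> m"
    using \<rho> by simp
  then show "\<rho> ! i = \<sigma> ! i"
  proof (induction i rule: less_induct)
    case (less i)
    consider "i = 0" | "i = 1" | j where "i = Suc (Suc j)"
      by (metis One_nat_def not0_implies_Suc)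
    then show ?case
    proof cases
      case 3
      have IH: "\<rho> ! j = \<sigma> ! j" "\<rho> ! Suc j = \<sigma> ! Suc j"
        using less 3 by auto
      have "{\<sigma> ! Suc j, \<sigma> ! i} \<in> walk_edges \<sigma>"
        using 3 less.prems \<sigma> by (auto simp: walk_edges_def)
      then have "{\<rho> ! Suc j, \<sigma> ! i} \<in> walk_edges \<rho>"
        using IH assms(7) by simp
      then have "\<sigma> ! i = \<rho> ! i \<or> \<sigma> ! i = \<sigma> ! j"
        using closed_walk_neighbour_iff[OF \<rho>, of "Suc j"] 3 less.prems IH by auto
      \<comment> \<open>Returning to the vertex two steps back would need \<open>i = m\<close> and
        \<open>j = 0\<close>, hence \<open>m = 2\<close>; this is where \<open>3 \<le> m\<close>
        enters.\<close>
      moreover have "\<sigma> ! i \<noteq> \<sigma> ! j"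
      proof
        assume eq: "\<sigma> ! i = \<sigma> ! j"
        then have "i = m"
          using inj[of i j] 3 less.prems by (cases "i = m") auto
        then show False
          using inj[of 0 j] eq 3 \<sigma>(3) assms(10) by auto
      qed
      ultimately show ?thesis
        by simp
    qed (use assms in auto)
  qed
qed (use assms in simp)

section \<open>Polygons as oriented tours from the maximal vertex\<close>

definition closing_first :: "nat \<Rightarrow> 'd::{finite,linorder} vertex list set" where
  "closing_first n = {\<gamma> \<in> First n. closes \<gamma>}"

text \<open>\<open>\<gamma> ! 1\<close> and \<open>\<gamma> ! n\<close> are the neighbours of 0
  along the polygon; the condition selects the direction of traversal that \<open>tour\<close>
  prescribes.\<close>

definition closing_oriented :: "nat \<Rightarrow> 'd::{finite,linorder} vertex list set" where
  "closing_oriented n = {\<gamma> \<in> closing_first n. (\<gamma> ! n, \<gamma> ! 1) \<in> vertex_less}"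

definition reorient :: "'d::{finite,linorder} vertex list \<Rightarrow> 'd vertex list" where
  "reorient \<gamma> = hd \<gamma> # rev (tl \<gamma>)"

lemma closing_firstE:
  assumes "\<gamma> \<in> closing_first n" "1 \<le> n"
  obtains xs where "\<gamma> = 0 # xs" "length xs = n" "xs \<noteq> []"
    "successively adjacent xs" "distinct xs" "0 \<notin> set xs" "adjacent 0 (hd xs)" "adjacent 0 (last xs)"
    "\<forall>v\<in>set xs. (v, 0) \<in> vertex_less"
proof -
  obtain xs where "\<gamma> = 0 # xs" "length xs = n"
    using assms First_eq_Cons by (auto simp: closing_first_def)
  then show ?thesis
    using assms
    by (intro that[of xs])
      (auto simp: closing_first_def First_iff self_avoiding_walk_iff closes_def successively_Cons
        adjacent_sym split: if_splits)
qed

lemma reorient_closing_first: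
  assumes "\<gamma> \<in> closing_first n" "1 \<le> n"
  shows "reorient \<gamma> \<in> closing_first n" "cycle_edges (reorient \<gamma>) = cycle_edges \<gamma>"
    "reorient \<gamma> ! n = \<gamma> ! 1" "reorient \<gamma> ! 1 = \<gamma> ! n" "reorient (reorient \<gamma>) = \<gamma>"
proof -
  from assms obtain xs where \<gamma>: "\<gamma> = 0 # xs" "length xs = n" "xs \<noteq> []"
    "successively adjacent xs" "distinct xs" "0 \<notin> set xs" "adjacent 0 (hd xs)" "adjacent 0 (last xs)"
    "\<forall>v\<in>set xs. (v, 0) \<in> vertex_less"
    by (rule closing_firstE)
  then show "reorient \<gamma> \<in> closing_first n"
    by (auto simp: closing_first_def First_iff self_avoiding_walk_iff closes_def successively_Cons
        adjacent_sym reorient_def hd_rev last_rev)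
  show "cycle_edges (reorient \<gamma>) = cycle_edges \<gamma>"
    using walk_edges_rev[of "0 # xs @ [0]"] by (simp add: \<gamma> cycle_edges_def reorient_def)
  show "reorient \<gamma> ! n = \<gamma> ! 1" "reorient \<gamma> ! 1 = \<gamma> ! n"
    using \<gamma>(2,3) by (auto simp: \<gamma>(1) reorient_def rev_nth nth_Cons')
  show "reorient (reorient \<gamma>) = \<gamma>"
    by (simp add: \<gamma> reorient_def)
qed

lemma closing_first_subset:
  assumes "2 \<le> n"
  shows "closing_first n \<subseteq> closing_oriented n \<union> reorient ` closing_oriented n"
proof
  fix \<gamma> assume \<gamma>: "\<gamma> \<in> closing_first n"
  have "distinct \<gamma>" "length \<gamma> = Suc n"
    using \<gamma> by (auto simp: closing_first_def First_iff self_avoiding_walk_iff)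
  then have "\<gamma> ! n \<noteq> \<gamma> ! 1"
    using assms by (simp add: nth_eq_iff_index_eq)
  then consider "(\<gamma> ! n, \<gamma> ! 1) \<in> vertex_less" | "(\<gamma> ! 1, \<gamma> ! n) \<in> vertex_less"
    using vertex_less_total by blast
  then show "\<gamma> \<in> closing_oriented n \<union> reorient ` closing_oriented n"
  proof cases
    case 2
    then have "reorient \<gamma> \<in> closing_oriented n"
      using reorient_closing_first[OF \<gamma>] assms by (simp add: closing_oriented_def)
    then show ?thesis
      using reorient_closing_first(5)[OF \<gamma>] assms by (metis UnCI imageI le_trans one_le_numeral)
  qed (use \<gamma> in \<open>simp add: closing_oriented_def\<close>)
qed

lemma finite_closing_oriented: "finite (closing_oriented n)"
  by (rule finite_subset[OF _ finite_First[of n]])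
    (auto simp: closing_oriented_def closing_first_def)

text \<open>Every tour is oriented or the reversal of an oriented one, which is the source of the
  factor 2 in the final bound.\<close>

lemma card_closing_first_le:
  assumes "2 \<le> n"
  shows "card (closing_first n :: 'd::{finite,linorder} vertex list set)
    \<le> 2 * card (closing_oriented n :: 'd vertex list set)"
proof -
  let ?T = "closing_oriented n :: 'd vertex list set"
  have "card (closing_first n :: 'd vertex list set) \<le> card (?T \<union> reorient ` ?T)"
    using closing_first_subset[OF assms] by (intro card_mono) (auto simp: finite_closing_oriented)
  also have "\<dots> \<le> card ?T + card (reorient ` ?T)"
    by (rule card_Un_le)
  also have "\<dots> \<le> 2 * card ?T"
    using card_image_le[OF finite_closing_oriented, of reorient n] by simp
  finally show ?thesis .
qed

text \<open>The neighbours of 0 along the polygon are \<open>\<gamma> ! 1\<close> and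
  \<open>\<gamma> ! n\<close>, and orientation makes the former the larger;
  \<open>closed_walk_unique\<close> then shows that the definite description has no other
  solution.\<close>

lemma tour_cycle_edges:
  assumes "\<gamma> \<in> closing_oriented n" "2 \<le> n"
  shows "tour (Suc n) (cycle_edges \<gamma>) = \<gamma> @ [0]"
proof -
  have \<gamma>: "\<gamma> \<in> closing_first n" "(\<gamma> ! n, \<gamma> ! 1) \<in> vertex_less"
    using assms by (auto simp: closing_oriented_def)
  then obtain xs where xs: "\<gamma> = 0 # xs" "length xs = n" "distinct xs" "0 \<notin> set xs"
    using closing_firstE[of \<gamma> n] assms by auto
  let ?\<rho> = "\<gamma> @ [0]"
  have \<rho>: "length ?\<rho> = Suc (Suc n)" "distinct (butlast ?\<rho>)" "?\<rho> ! (Suc n) = ?\<rho> ! 0"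
    using xs by (auto simp: nth_append)
  have edges: "walk_edges ?\<rho> = cycle_edges \<gamma>"
    by (simp add: cycle_edges_def xs)
  have nth: "?\<rho> ! 0 = 0" "?\<rho> ! Suc 0 = \<gamma> ! 1" "?\<rho> ! n = \<gamma> ! n"
    using xs assms(2) by (auto simp: nth_append)
  have "{0, v} \<in> cycle_edges \<gamma> \<longleftrightarrow> v = \<gamma> ! 1 \<or> v = \<gamma> ! n" for v
    using closed_walk_neighbour_iff[OF \<rho>, of 0 v] unfolding edges nth by (simp add: nth)
  then have "{v. {0, v} \<in> cycle_edges \<gamma>} = {\<gamma> ! 1, \<gamma> ! n}"
    by auto
  moreover have "NE {\<gamma> ! 1, \<gamma> ! n} = \<gamma> ! 1"
    using \<gamma>(2) by (intro NE_eqI) auto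
  ultimately have NE: "NE {v. {0, v} \<in> cycle_edges \<gamma>} = ?\<rho> ! 1"
    using xs assms(2) by (simp add: nth_append)
  show ?thesis
    unfolding tour_def
  proof (rule the_equality)
    show "length ?\<rho> = Suc (Suc n) \<and> distinct (butlast ?\<rho>) \<and> walk_edges ?\<rho> = cycle_edges \<gamma> \<and>
        ?\<rho> ! 0 = 0 \<and> ?\<rho> ! (Suc n) = 0 \<and> ?\<rho> ! 1 = NE {v. {0, v} \<in> cycle_edges \<gamma>}"
      using \<rho> edges NE xs by (auto simp: nth_append)
  next
    fix \<phi> assume "length \<phi> = Suc (Suc n) \<and> distinct (butlast \<phi>) \<and> walk_edges \<phi> = cycle_edges \<gamma> \<and>
        \<phi> ! 0 = 0 \<and> \<phi> ! (Suc n) = 0 \<and> \<phi> ! 1 = NE {v. {0, v} \<in> cycle_edges \<gamma>}"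
    then show "\<phi> = ?\<rho>"
      using \<rho> edges NE xs assms(2) by (intro closed_walk_unique[of \<phi> "Suc n"]) auto
  qed
qed

text \<open>A closing walk can be rotated to start at its maximal vertex, and reversed if necessary,
  without changing its polygon.\<close>

lemma SAP_eq:
  assumes "odd n" "3 \<le> n"
  shows "SAP (Suc n) = cycle_edges ` closing_oriented n"
proof (intro equalityI subsetI)
  fix P :: "'a vertex set set" assume "P \<in> SAP (Suc n)"
  then obtain \<gamma> where \<gamma>: "self_avoiding_walk n \<gamma>" "closes \<gamma>" "P = cycle_edges \<gamma>" "NE (\<Union>P) = 0"
    by (auto simp: SAP_def polygon_def cycle_edges_eq self_avoiding_walk_not_Nil)
  have ne: "\<gamma> \<noteq> []"
    using \<gamma> self_avoiding_walk_not_Nil by blast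
  have NE: "NE (set \<gamma>) = 0"
    using \<gamma> ne by (simp add: Union_cycle_edges)
  then have "0 \<in> set \<gamma>"
    using NE_in[of "set \<gamma>"] ne by simp
  then obtain i where i: "i < length \<gamma>" "\<gamma> ! i = 0"
    by (auto simp: in_set_conv_nth)
  then have "rotate i \<gamma> \<in> closing_first n"
    using rotate_closing_walk[OF \<gamma>(1,2), of i] NE ne
    by (auto simp: closing_first_def First_def SAW_def hd_rotate_conv_nth)
  then have "rotate i \<gamma> \<in> closing_oriented n \<or> rotate i \<gamma> \<in> reorient ` closing_oriented n"
    using closing_first_subset[of n] assms by auto
  then show "P \<in> cycle_edges ` closing_oriented n"
  proof
    assume "rotate i \<gamma> \<in> closing_oriented n"
    then show ?thesis
      using \<gamma>(3) cycle_edges_rotate by blast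
  next
    assume "rotate i \<gamma> \<in> reorient ` closing_oriented n"
    then obtain \<sigma> where \<sigma>: "\<sigma> \<in> closing_oriented n" "rotate i \<gamma> = reorient \<sigma>"
      by blast
    then have "cycle_edges \<sigma> = cycle_edges (rotate i \<gamma>)"
      using reorient_closing_first(2)[of \<sigma> n] assms by (simp add: closing_oriented_def)
    then show ?thesis
      using \<sigma>(1) \<gamma>(3) by auto
  qed
next
  fix P :: "'a vertex set set" assume "P \<in> cycle_edges ` closing_oriented n"
  then obtain \<gamma> where \<gamma>: "\<gamma> \<in> First n" "closes \<gamma>" "P = cycle_edges \<gamma>"
    by (auto simp: closing_oriented_def closing_first_def)
  then have "self_avoiding_walk n \<gamma>" "NE (set \<gamma>) = 0" "\<gamma> \<noteq> []"
    using self_avoiding_walk_not_Nil by (auto simp: First_def SAW_def)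
  then show "P \<in> SAP (Suc n)"
    using \<gamma> assms Union_cycle_edges[of \<gamma>]
    by (auto simp: SAP_def polygon_def intro!: exI[of _ \<gamma>] cycle_edges_eq)
qed

text \<open>\<open>tour\<close> recovers the walk from its edges; together with
  \<open>SAP_eq\<close> this makes polygons and oriented tours equinumerous.\<close>

lemma inj_on_cycle_edges:
  assumes "2 \<le> n"
  shows "inj_on cycle_edges (closing_oriented n)"
proof (rule inj_onI)
  fix \<gamma> \<gamma>' :: "'a vertex list"
  assume "\<gamma> \<in> closing_oriented n" "\<gamma>' \<in> closing_oriented n" "cycle_edges \<gamma> = cycle_edges \<gamma>'"
  then have "\<gamma> @ [0] = \<gamma>' @ [0]"
    using tour_cycle_edges[OF _ assms] by metis
  then show "\<gamma> = \<gamma>'"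
    by simp
qed

lemma finite_SAP: "odd n \<Longrightarrow> 3 \<le> n \<Longrightarrow> finite (SAP (Suc n))"
  by (subst SAP_eq) (simp_all add: finite_closing_oriented)

text \<open>A closing walk is determined by the index at which it attains its maximal vertex, and by the
  closed tour that starts there.\<close>

lemma card_closing_le:
  assumes "odd n" "3 \<le> n"
  shows "card {\<gamma> \<in> SAW n. closes (\<gamma> :: 'd::{finite,linorder} vertex list)}
    \<le> 2 * (n + 1) * card (SAP (Suc n) :: 'd vertex set set set)"
proof -
  \<comment> \<open>Rotation by \<open>n + 1 - i\<close> undoes the rotation by \<open>i\<close>
    that brings the maximal vertex to the front; the translation restores the start at 0.\<close>
  define f where "f = (\<lambda>(\<sigma>, i). let \<tau> = rotate (n + 1 - i) \<sigma> in
    map (\<lambda>x. x - hd \<tau>) \<tau> :: 'd vertex list)"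
  have "{\<gamma> \<in> SAW n. closes \<gamma>} \<subseteq> f ` (closing_first n \<times> {..n})"
  proof
    fix \<gamma> :: "'d vertex list" assume "\<gamma> \<in> {\<gamma> \<in> SAW n. closes \<gamma>}"
    then have \<gamma>: "self_avoiding_walk n \<gamma>" "hd \<gamma> = 0" "closes \<gamma>" "\<gamma> \<noteq> []" "length \<gamma> = n + 1"
      by (auto simp: SAW_def self_avoiding_walk_iff)
    define v where "v = NE (set \<gamma>)"
    have "v \<in> set \<gamma>"
      using NE_in[of "set \<gamma>"] \<gamma> by (simp add: v_def)
    then obtain i where i: "i < n + 1" "\<gamma> ! i = v"
      using \<gamma>(5) by (auto simp: in_set_conv_nth)
    let ?\<sigma> = "map (\<lambda>x. x - v) (rotate i \<gamma>)"
    have "?\<sigma> \<in> closing_first n"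
      using rotate_closing_walk[OF \<gamma>(1,3), of i] \<gamma> i
      by (auto simp: closing_first_def First_def SAW_def self_avoiding_walk_diff hd_map
          hd_rotate_conv_nth NE_diff simp flip: v_def)
    moreover have "rotate (n + 1 - i) ?\<sigma> = map (\<lambda>x. x - v) \<gamma>"
      using \<gamma>(5) i by (simp add: rotate_map rotate_rotate rotate_id del: rotate_Suc)
    then have "f (?\<sigma>, i) = \<gamma>"
      using \<gamma> by (simp add: f_def hd_map comp_def)
    ultimately show "\<gamma> \<in> f ` (closing_first n \<times> {..n})"
      using i by (intro image_eqI[of _ _ "(?\<sigma>, i)"]) auto
  qed
  moreover have fin: "finite (closing_first n :: 'd vertex list set)"
    by (rule finite_subset[OF _ finite_First[of n]]) (auto simp: closing_first_def)
  ultimately have "card {\<gamma> \<in> SAW n. closes (\<gamma> :: 'd vertex list)}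
      \<le> card (closing_first n \<times> {..n} :: ('d vertex list \<times> nat) set)"
    by (intro surj_card_le) auto
  also have "\<dots> = card (closing_first n :: 'd vertex list set) * (n + 1)"
    by (simp add: card_cartesian_product)
  also have "\<dots> \<le> 2 * card (closing_oriented n :: 'd vertex list set) * (n + 1)"
    using card_closing_first_le[of n] assms by (intro mult_right_mono) auto
  also have "card (closing_oriented n :: 'd vertex list set) = card (SAP (Suc n) :: 'd vertex set set set)"
    using assms by (subst SAP_eq) (auto simp: card_image inj_on_cycle_edges)
  finally show ?thesis
    by (simp add: algebra_simps)
qed

section \<open>Second parts and initial segments of polygons\<close>

text \<open>The last condition says, for \<open>k \<ge> 1\<close>, that \<open>\<phi>\<close> is the
  lexicographically smaller part: lists that share only 0 are compared at index 1, and
  \<open>[0]\<close> is a proper prefix. Stated with \<open>\<gamma> ! 1\<close>, it does not vary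
  with \<open>k\<close>.\<close>

definition second_parts :: "nat \<Rightarrow> nat \<Rightarrow> 'd::{finite,linorder} vertex list \<Rightarrow> 'd vertex list set" where
  "second_parts r k \<gamma> = {\<phi> \<in> First r. set \<phi> \<inter> set (take (Suc k) \<gamma>) = {0} \<and>
     (r = 0 \<or> (\<phi> ! 1, \<gamma> ! 1) \<in> vertex_less)}"

lemma finite_second_parts: "finite (second_parts r k \<gamma>)"
  by (rule finite_subset[OF _ finite_First[of r]]) (auto simp: second_parts_def)

text \<open>When a tour is cut after \<open>l\<close> steps, the rest read backwards from 0 is a
  second part, and the two pieces determine the tour. That their ends are adjacent is not recorded,
  so an upper bound results.\<close>

lemma card_SAP_first_le:
  assumes "odd n" "3 \<le> n" "1 \<le> l" "l \<le> n" "finite C"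
  shows "card {P \<in> SAP (Suc n). take (Suc l) (tour (Suc n) P) \<in> C}
    \<le> (\<Sum>\<gamma>\<in>C. card (second_parts (n - l) l \<gamma>))"
proof -
  let ?T = "{\<gamma> \<in> closing_oriented n. take (Suc l) \<gamma> \<in> C}"
  define f where "f \<gamma> = (take (Suc l) \<gamma>, 0 # rev (drop (Suc l) \<gamma>))" for \<gamma> :: "'a vertex list"
  have len: "length \<gamma> = Suc n" if "\<gamma> \<in> closing_oriented n" for \<gamma> :: "'a vertex list"
    using that by (auto simp: closing_oriented_def closing_first_def First_iff self_avoiding_walk_iff)
  have "{P \<in> SAP (Suc n). take (Suc l) (tour (Suc n) P) \<in> C} = cycle_edges ` ?T"
    using assms by (auto simp: SAP_eq tour_cycle_edges len simp del: take_Suc)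
  then have "card {P \<in> SAP (Suc n). take (Suc l) (tour (Suc n) P) \<in> C} \<le> card ?T"
    by (simp add: card_image_le finite_closing_oriented)
  also have "card ?T \<le> card (SIGMA \<gamma>:C. second_parts (n - l) l \<gamma>)"
  proof (rule card_inj_on_le)
    show "inj_on f ?T"
    proof (rule inj_onI)
      fix \<gamma> \<gamma>' :: "'a vertex list" assume "f \<gamma> = f \<gamma>'"
      then have "take (Suc l) \<gamma> = take (Suc l) \<gamma>'" "drop (Suc l) \<gamma> = drop (Suc l) \<gamma>'"
        by (simp_all add: f_def)
      then show "\<gamma> = \<gamma>'"
        by (metis append_take_drop_id)
    qed
    show "f ` ?T \<subseteq> (SIGMA \<gamma>:C. second_parts (n - l) l \<gamma>)"
    proof (rule image_subsetI)
      fix \<gamma> :: "'a vertex list" assume \<gamma>: "\<gamma> \<in> ?T"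
      then have C: "take (Suc l) \<gamma> \<in> C"
        by blast
      from \<gamma> have \<gamma>: "\<gamma> \<in> closing_first n" "(\<gamma> ! n, \<gamma> ! 1) \<in> vertex_less"
        by (auto simp: closing_oriented_def)
      then obtain xs where xs: "\<gamma> = 0 # xs" "length xs = n"
        "successively adjacent xs" "distinct xs" "0 \<notin> set xs" "adjacent 0 (last xs)"
        "\<forall>v\<in>set xs. (v, 0) \<in> vertex_less"
        using closing_firstE[of \<gamma> n] assms by auto
      have sa: "successively adjacent (drop l xs)"
        using xs(3) successively_append_iff[of adjacent "take l xs" "drop l xs"] by simp
      have "0 # rev (drop l xs) \<in> First (n - l)"
        using xs sa in_set_dropD[of _ l xs]
        by (cases "l < n") (auto simp: First_iff self_avoiding_walk_iff successively_Cons hd_rev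
            simp del: successively_rev)
      moreover have "set (0 # rev (drop l xs)) \<inter> set (take (Suc l) (take (Suc l) \<gamma>)) = {0}"
        using xs set_take_disj_set_drop_if_distinct[of xs l l] in_set_dropD[of _ l xs]
          in_set_takeD[of _ l xs] by auto
      \<comment> \<open>The reversed rest first steps to \<open>\<gamma> ! n\<close>, the smaller
        neighbour of 0; for \<open>l = n\<close> it consists of 0 alone.\<close>
      moreover have "rev (drop l xs) ! 0 = xs ! (n - 1)" if "l < n"
        using that xs by (simp add: rev_nth)
      then have "n - l = 0 \<or> ((0 # rev (drop l xs)) ! 1, take (Suc l) \<gamma> ! 1) \<in> vertex_less"
        using \<gamma>(2) xs assms by (cases "l < n") (auto simp: nth_Cons')
      ultimately show "f \<gamma> \<in> (SIGMA \<gamma>:C. second_parts (n - l) l \<gamma>)"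
        using C by (auto simp: f_def second_parts_def xs(1))
    qed
  qed (auto simp: assms finite_second_parts)
  also have "\<dots> = (\<Sum>\<gamma>\<in>C. card (second_parts (n - l) l \<gamma>))"
    by (simp add: card_SigmaI assms finite_second_parts)
  finally show ?thesis .
qed

section \<open>Two-part decomposition\<close>

text \<open>A self-avoiding walk visits its maximal vertex only once, here at index
  \<open>length g - 1\<close>, so \<open>two_part\<close> finds \<open>g\<close> as its backward and
  \<open>p\<close> as its forward list.\<close>

lemma two_part_join:
  assumes \<psi>: "rev g @ tl p \<in> SAW0 m" and "g \<noteq> []" "p \<noteq> []" "hd g = 0" "hd p = 0"
  shows "two_part (rev g @ tl p) = (if (g, p) \<in> lexord vertex_less then (p, g) else (g, p))"
proof -
  obtain g' p' where gp: "g = 0 # g'" "p = 0 # p'"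
    using assms by (metis list.exhaust_sel)
  define \<psi> where "\<psi> = rev g @ tl p"
  let ?j = "length g'"
  have j: "?j < length \<psi>" "\<psi> ! ?j = 0"
    by (simp_all add: \<psi>_def gp nth_append)
  have "distinct \<psi>" "NE (set \<psi>) = 0"
    using \<psi> by (simp_all add: \<psi>_def SAW0_def self_avoiding_walk_iff)
  then have "(THE j. j < length \<psi> \<and> \<psi> ! j = NE (set \<psi>)) = ?j"
    using j by (intro the_equality) (simp, metis nth_eq_iff_index_eq)
  moreover have "rev (take (Suc ?j) \<psi>) = g" "drop ?j \<psi> = p"
    by (simp_all add: \<psi>_def gp)
  ultimately show ?thesis
    unfolding two_part_def \<psi>_def[symmetric] by (simp add: Let_def)
qed

lemma join_mem_SAW0:
  assumes "g \<in> First k" "p \<in> First r" "set p \<inter> set g = {0}"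
  shows "rev g @ tl p \<in> SAW0 (k + r)"
proof -
  obtain g' p' where gp: "g = 0 # g'" "length g' = k" "p = 0 # p'" "length p' = r"
    using First_eq_Cons[OF assms(1)] First_eq_Cons[OF assms(2)] by blast
  have "self_avoiding_walk (k + r) (rev g @ tl p)"
    using assms gp by (subst self_avoiding_walk_join) (auto simp: First_iff)
  then show ?thesis
    using assms gp by (auto simp: SAW0_iff First_iff)
qed

lemma SAW0_eq_join:
  assumes "\<psi> \<in> SAW0 m"
  obtains g p k r where "\<psi> = rev g @ tl p" "g \<in> First k" "p \<in> First r" "k + r = m" "set p \<inter> set g = {0}"
proof -
  have \<psi>: "self_avoiding_walk m \<psi>" "0 \<in> set \<psi>" "\<forall>v\<in>set \<psi>. v \<noteq> 0 \<longrightarrow> (v, 0) \<in> vertex_less"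
    using assms by (auto simp: SAW0_iff)
  then obtain a b where ab: "\<psi> = a @ 0 # b"
    by (meson split_list)
  let ?g = "0 # rev a" and ?p = "0 # b"
  have len: "length a + length b = m"
    using \<psi>(1) ab by (simp add: self_avoiding_walk_iff)
  have eq: "\<psi> = rev ?g @ tl ?p"
    by (simp add: ab)
  then have "self_avoiding_walk (length a) ?g \<and> self_avoiding_walk (length b) ?p \<and> set ?g \<inter> set ?p = {0}"
    using self_avoiding_walk_join[of ?g ?p m] \<psi>(1) len by simp
  then have "?g \<in> First (length a)" "?p \<in> First (length b)" "set ?p \<inter> set ?g = {0}"
    using \<psi>(3) ab by (auto simp: First_iff)
  then show ?thesis
    using that[OF eq] len by blast
qed

text \<open>The lists share only 0, so they first differ at index 1, unless \<open>r = 0\<close>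
  makes \<open>p\<close> a proper prefix. Both tests are needed, since the first part may run along
  the walk or against it.\<close>

lemma lexord_First_iff:
  assumes "g \<in> First k" "p \<in> First r" "1 \<le> k" "set p \<inter> set g = {0}"
  shows "(p, g) \<in> lexord vertex_less \<longleftrightarrow> r = 0 \<or> (p ! 1, g ! 1) \<in> vertex_less"
    and "(g, p) \<notin> lexord vertex_less \<longleftrightarrow> r = 0 \<or> (p ! 1, g ! 1) \<in> vertex_less"
proof -
  obtain g' p' where gp: "g = 0 # g'" "length g' = k" "p = 0 # p'" "length p' = r" "0 \<notin> set g'"
    using First_eq_Cons[OF assms(1)] First_eq_Cons[OF assms(2)] assms(1)
    by (auto simp: First_iff self_avoiding_walk_iff)
  obtain x g'' where g'': "g' = x # g''"
    using gp assms(3) by (cases g') auto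
  have "((p, g) \<in> lexord vertex_less \<longleftrightarrow> r = 0 \<or> (p ! 1, g ! 1) \<in> vertex_less) \<and>
      ((g, p) \<notin> lexord vertex_less \<longleftrightarrow> r = 0 \<or> (p ! 1, g ! 1) \<in> vertex_less)"
  proof (cases p')
    case Nil
    then show ?thesis
      using gp g'' by auto
  next
    case (Cons y p'')
    then have "x \<noteq> y"
      using assms(4) gp g'' by auto
    then have "(x, y) \<notin> vertex_less \<longleftrightarrow> (y, x) \<in> vertex_less"
      using vertex_less_total vertex_less_asym by metis
    then show ?thesis
      using gp g'' Cons \<open>x \<noteq> y\<close> by auto
  qed
  then show "(p, g) \<in> lexord vertex_less \<longleftrightarrow> r = 0 \<or> (p ! 1, g ! 1) \<in> vertex_less"
    and "(g, p) \<notin> lexord vertex_less \<longleftrightarrow> r = 0 \<or> (p ! 1, g ! 1) \<in> vertex_less"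
    by auto
qed

lemma take_mem_First:
  assumes "\<gamma> \<in> First l" "k \<le> l"
  shows "take (Suc k) \<gamma> \<in> First k"
proof -
  have "successively adjacent (take (Suc k) \<gamma>)"
    using assms successively_append_iff[of adjacent "take (Suc k) \<gamma>" "drop (Suc k) \<gamma>"]
    by (simp add: First_iff self_avoiding_walk_iff)
  then show ?thesis
    using assms by (auto simp: First_iff self_avoiding_walk_iff dest: in_set_takeD)
qed

text \<open>The second piece is there because a walk and its reversal have the same two parts.\<close>

lemma first_part_fibre:
  assumes \<gamma>: "\<gamma> \<in> First l" and k: "1 \<le> k" "k \<le> l"
  defines "F \<equiv> \<lambda>p. rev (take (Suc k) \<gamma>) @ tl p"
  shows "{\<psi> \<in> SAW0 (k + r). first_part \<psi> = take (Suc k) \<gamma>} =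
    F ` second_parts r k \<gamma> \<union> rev ` F ` second_parts r k \<gamma>"
proof -
  define g where "g = take (Suc k) \<gamma>"
  have g: "g \<in> First k"
    using take_mem_First \<gamma> k by (simp add: g_def)
  then obtain g' where g': "g = 0 # g'" "length g' = k"
    using First_eq_Cons by blast
  have "g ! 1 = \<gamma> ! 1"
    using k by (simp add: g_def)
  then have A: "second_parts r k \<gamma> =
      {p \<in> First r. set p \<inter> set g = {0} \<and> (r = 0 \<or> (p ! 1, g ! 1) \<in> vertex_less)}"
    by (simp add: second_parts_def g_def)
  have F: "F p = rev g @ tl p" for p
    by (simp add: F_def g_def)
  \<comment> \<open>Reversing a joined walk exchanges the roles of the two parts.\<close>
  have rev_F: "rev (F p) = rev p @ tl g" if "p \<in> First r" for p
    using First_eq_Cons[OF that] by (auto simp: F g')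
  show ?thesis
    unfolding g_def[symmetric]
  proof (intro equalityI subsetI)
    fix \<psi> assume "\<psi> \<in> {\<psi> \<in> SAW0 (k + r). first_part \<psi> = g}"
    then have \<psi>: "\<psi> \<in> SAW0 (k + r)" "fst (two_part \<psi>) = g"
      by (auto simp: first_part_def)
    from \<psi>(1) obtain a b i j where ab: "\<psi> = rev a @ tl b" "a \<in> First i" "b \<in> First j"
        "i + j = k + r" "set b \<inter> set a = {0}"
      by (rule SAW0_eq_join)
    obtain a' b' where ab': "a = 0 # a'" "length a' = i" "b = 0 # b'" "length b' = j"
      using First_eq_Cons[OF ab(2)] First_eq_Cons[OF ab(3)] by blast
    have two: "two_part \<psi> = (if (a, b) \<in> lexord vertex_less then (b, a) else (a, b))"
      using two_part_join[of a b "k + r"] \<psi>(1) ab(1) ab' by simp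
    show "\<psi> \<in> F ` second_parts r k \<gamma> \<union> rev ` F ` second_parts r k \<gamma>"
    proof (cases "(a, b) \<in> lexord vertex_less")
      case True
      then have "b = g"
        using two \<psi>(2) by simp
      then have "i = r"
        using ab(4) ab' g' by simp
      then have "a \<in> second_parts r k \<gamma>"
        unfolding A using ab(2,5) True lexord_First_iff(1)[OF g ab(2) k(1)] \<open>b = g\<close>
        by (simp add: Int_commute)
      moreover have "\<psi> = rev (F a)"
        using rev_F[of a] ab(1,2) \<open>b = g\<close> \<open>i = r\<close> by simp
      ultimately show ?thesis
        by blast
    next
      case False
      then have "a = g"
        using two \<psi>(2) by simp
      then have "j = r"
        using ab(4) ab' g' by simp
      then have "b \<in> second_parts r k \<gamma>"
        unfolding A using ab(3,5) False lexord_First_iff(2)[OF g ab(3) k(1)] \<open>a = g\<close> by simp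
      moreover have "\<psi> = F b"
        using ab(1) \<open>a = g\<close> by (simp add: F)
      ultimately show ?thesis
        by blast
    qed
  next
    fix \<psi> assume "\<psi> \<in> F ` second_parts r k \<gamma> \<union> rev ` F ` second_parts r k \<gamma>"
    then obtain p where pA: "p \<in> second_parts r k \<gamma>" and "\<psi> = F p \<or> \<psi> = rev (F p)"
      by blast
    have p: "p \<in> First r" "set p \<inter> set g = {0}" "r = 0 \<or> (p ! 1, g ! 1) \<in> vertex_less"
      using pA unfolding A by blast+
    have \<psi>: "\<psi> = rev g @ tl p \<or> \<psi> = rev p @ tl g"
      using \<open>\<psi> = F p \<or> \<psi> = rev (F p)\<close> rev_F[OF p(1)] F[of p] by simp
    obtain p' where p': "p = 0 # p'"
      using First_eq_Cons[OF p(1)] by blast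
    from \<psi> show "\<psi> \<in> {\<psi> \<in> SAW0 (k + r). first_part \<psi> = g}"
    proof
      assume eq: "\<psi> = rev g @ tl p"
      then have "\<psi> \<in> SAW0 (k + r)"
        using join_mem_SAW0[OF g p(1,2)] by simp
      moreover from this have "two_part \<psi> = (g, p)"
        using two_part_join[of g p "k + r"] lexord_First_iff(2)[OF g p(1) k(1) p(2)] p(3) g' p' eq
        by simp
      ultimately show ?thesis
        by (simp add: first_part_def)
    next
      assume eq: "\<psi> = rev p @ tl g"
      then have "\<psi> \<in> SAW0 (k + r)"
        using join_mem_SAW0[OF p(1) g] p(2) by (simp add: Int_commute add.commute)
      moreover from this have "two_part \<psi> = (g, p)"
        using two_part_join[of p g "k + r"] lexord_First_iff(1)[OF g p(1) k(1) p(2)] p(3) g' p' eq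
        by simp
      ultimately show ?thesis
        by (simp add: first_part_def)
    qed
  qed
qed

text \<open>Every second part yields two walks, the joined one and its reversal, and both close
  exactly if it ends next to \<open>\<gamma> ! k\<close>. The flag \<open>c\<close> covers the
  counts with and without closing at once.\<close>

lemma card_first_part_fibre:
  assumes \<gamma>: "\<gamma> \<in> First l" and k: "1 \<le> k" "k \<le> l"
  shows "card {\<psi> \<in> SAW0 (k + r). first_part \<psi> = take (Suc k) \<gamma> \<and> (c \<longrightarrow> closes \<psi>)} =
    2 * card {p \<in> second_parts r k \<gamma>. c \<longrightarrow> adjacent (last p) (\<gamma> ! k)}"
proof -
  define g where "g = take (Suc k) \<gamma>"
  define F where "F p = rev g @ tl p" for p
  define A where "A = {p \<in> second_parts r k \<gamma>. c \<longrightarrow> adjacent (last p) (\<gamma> ! k)}"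
  have len: "length \<gamma> = Suc l"
    using \<gamma> by (simp add: First_iff self_avoiding_walk_iff)
  have g: "g \<in> First k"
    using take_mem_First \<gamma> k by (simp add: g_def)
  then obtain g' where g': "g = 0 # g'" "length g' = k"
    using First_eq_Cons by blast
  have "last g = \<gamma> ! k"
    using len k by (simp add: g_def take_Suc_conv_app_nth)
  have sp: "p \<in> First r" "set p \<inter> set g = {0}" if "p \<in> second_parts r k \<gamma>" for p
    using that by (auto simp: second_parts_def g_def)
  have closes_F: "closes (F p) \<longleftrightarrow> adjacent (last p) (\<gamma> ! k)" if p: "p \<in> second_parts r k \<gamma>" for p
  proof -
    have "last (F p) = last p" "hd (F p) = last g"
      using First_eq_Cons[OF sp(1)[OF p]] g' by (auto simp: F_def hd_append hd_rev)
    then show ?thesis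
      using \<open>last g = \<gamma> ! k\<close> by (simp add: closes_def)
  qed
  have "{\<psi> \<in> SAW0 (k + r). first_part \<psi> = take (Suc k) \<gamma>} =
      F ` second_parts r k \<gamma> \<union> rev ` F ` second_parts r k \<gamma>"
    unfolding F_def g_def by (rule first_part_fibre[OF assms])
  then have "{\<psi> \<in> SAW0 (k + r). first_part \<psi> = take (Suc k) \<gamma> \<and> (c \<longrightarrow> closes \<psi>)} =
      {\<psi> \<in> F ` second_parts r k \<gamma> \<union> rev ` F ` second_parts r k \<gamma>. c \<longrightarrow> closes \<psi>}"
    by blast
  also have "\<dots> = F ` A \<union> rev ` F ` A"
    unfolding A_def using closes_F by auto
  finally have eq: "{\<psi> \<in> SAW0 (k + r). first_part \<psi> = take (Suc k) \<gamma> \<and> (c \<longrightarrow> closes \<psi>)} =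
      F ` A \<union> rev ` F ` A" .
  have tl: "p = 0 # tl p" if "p \<in> A" for p
    using First_eq_Cons[OF sp(1)] that by (force simp: A_def)
  have inj: "inj_on F A"
  proof (rule inj_onI)
    fix p q assume "p \<in> A" "q \<in> A" "F p = F q"
    then show "p = q"
      using tl[of p] tl[of q] by (simp add: F_def)
  qed
  \<comment> \<open>As 0 occurs only once, \<open>F p = rev (F q)\<close> would give
    \<open>q = g\<close>; but \<open>q\<close> meets \<open>g\<close> only at 0, while
    \<open>g\<close> has another vertex since \<open>k \<ge> 1\<close>.\<close>
  have "F ` A \<inter> rev ` F ` A = {}"
  proof (rule ccontr)
    assume "F ` A \<inter> rev ` F ` A \<noteq> {}"
    then obtain p q where pq: "p \<in> A" "q \<in> A" "F p = rev (F q)"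
      by auto
    obtain p' q' where p': "p = 0 # p'" and q': "q = 0 # q'"
      using tl pq by metis
    have "0 \<notin> set g'" "0 \<notin> set p'"
      using g sp(1)[of p] pq(1) by (auto simp: g' p' A_def First_iff self_avoiding_walk_iff)
    moreover have "rev g' @ 0 # p' = rev q' @ 0 # g'"
      using pq(3) by (simp add: F_def g' p' q')
    ultimately have "g' = q'"
      using append_Cons_eq_iff[of 0 "rev g'" p' "rev q'" g'] by simp
    then have "set g' \<subseteq> {0}"
      using sp(2)[of q] pq(2) by (auto simp: A_def g' q')
    then show False
      using \<open>0 \<notin> set g'\<close> g' k by (cases g') auto
  qed
  then have "card (F ` A \<union> rev ` F ` A) = 2 * card A"
    using finite_second_parts[of r k \<gamma>] inj
    by (subst card_Un_disjoint) (auto simp: A_def card_image inj_on_def)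
  then show ?thesis
    by (simp only: eq A_def)
qed

section \<open>Charming indices\<close>

text \<open>By \<open>card_first_part_fibre\<close> the conditional probability is a quotient of
  numbers of second parts, the factors 2 cancelling. Index 0 is excluded: \<open>[0]\<close> is a
  first part only of a walk of length 0, while parity forces \<open>l < n\<close> if
  \<open>k = 0\<close>.\<close>

lemma charming_card:
  fixes \<gamma> :: "'d::{finite,linorder} vertex list"
  assumes "charming \<alpha> n l \<gamma> k" and \<gamma>: "\<gamma> \<in> First l" and "odd n" "l \<le> n"
  shows "1 \<le> k"
    and "real n powr (- \<alpha>) * card (second_parts (n - l) k \<gamma>) <
      card {p \<in> second_parts (n - l) k \<gamma>. adjacent (last p) (\<gamma> ! k)}"
proof -
  define r where "r = n - l"
  let ?E = "{\<psi> :: 'd vertex list. first_part \<psi> = take (Suc k) \<gamma>}"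
  let ?S = "SAW0 (k + r) :: 'd vertex list set"
  have k: "k \<le> l" "even (l - k)"
    and cp: "real n powr (- \<alpha>) < cond_prob (measure_pmf (W0 (k + r))) closes (\<lambda>\<Gamma>. first_part \<Gamma> = take (Suc k) \<gamma>)"
    using assms(1) by (auto simp: charming_def r_def)
  have prob: "measure_pmf.prob (W0 (k + r)) X = card (?S \<inter> X) / card ?S" for X
    unfolding W0_def by (rule measure_pmf_of_set[OF SAW0_nonempty finite_SAW0])
  have pos: "card ?S > 0"
    by (simp add: card_gt_0_iff SAW0_nonempty finite_SAW0)
  have "cond_prob (measure_pmf (W0 (k + r))) closes (\<lambda>\<Gamma>. first_part \<Gamma> = take (Suc k) \<gamma>) =
      card (?S \<inter> {\<psi>. closes \<psi> \<and> \<psi> \<in> ?E}) / card (?S \<inter> ?E)"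
    using pos by (simp add: cond_prob_def prob)
  with cp have *: "real n powr (- \<alpha>) < card (?S \<inter> {\<psi>. closes \<psi> \<and> \<psi> \<in> ?E}) / card (?S \<inter> ?E)"
    by simp
  have ne: "?S \<inter> ?E \<noteq> {}"
  \<comment> \<open>For an empty event the quotient has denominator 0, hence value 0, which cannot
    exceed a power of \<open>n\<close>.\<close>
  proof
    assume "?S \<inter> ?E = {}"
    then have "real n powr (- \<alpha>) < 0"
      using * by simp
    then show False
      using powr_ge_zero[of "real n" "- \<alpha>"] by linarith
  qed
  show k1: "1 \<le> k"
  proof (rule ccontr)
    assume "\<not> 1 \<le> k"
    then have k0: "k = 0"
      by simp
    then have r: "r \<noteq> 0"
      using k(2) \<open>odd n\<close> \<open>l \<le> n\<close> by (cases "l = n") (simp_all add: r_def)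
    from ne obtain \<psi> where \<psi>: "\<psi> \<in> ?S" "first_part \<psi> = take (Suc k) \<gamma>"
      by blast
    from \<psi>(1) obtain g p i j where gp: "\<psi> = rev g @ tl p" "g \<in> First i" "p \<in> First j" "i + j = k + r"
      by (rule SAW0_eq_join)
    obtain g' p' where gp': "g = 0 # g'" "length g' = i" "p = 0 # p'" "length p' = j"
      using First_eq_Cons[OF gp(2)] First_eq_Cons[OF gp(3)] by blast
    obtain \<gamma>' where "\<gamma> = 0 # \<gamma>'"
      using First_eq_Cons[OF \<gamma>] by blast
    then have "fst (two_part \<psi>) = [0]"
      using \<psi>(2) by (simp add: first_part_def k0)
    moreover have "two_part \<psi> = (if (g, p) \<in> lexord vertex_less then (p, g) else (g, p))"
      using two_part_join[of g p "k + r"] \<psi>(1) gp(1) gp' by simp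
    ultimately show False
      using gp(4) k0 r gp' by (cases g'; cases p') (auto split: if_splits)
  qed
  have all: "card (?S \<inter> ?E) = 2 * card (second_parts r k \<gamma>)"
    using card_first_part_fibre[OF \<gamma> k1 k(1), of r False] by (simp add: Int_def)
  have closing: "card (?S \<inter> {\<psi>. closes \<psi> \<and> \<psi> \<in> ?E}) =
      2 * card {p \<in> second_parts r k \<gamma>. adjacent (last p) (\<gamma> ! k)}"
    using card_first_part_fibre[OF \<gamma> k1 k(1), of r True] by (simp add: Int_def conj_commute)
  have "card (?S \<inter> ?E) > 0"
    using ne by (simp add: card_gt_0_iff finite_SAW0)
  then show "real n powr (- \<alpha>) * card (second_parts (n - l) k \<gamma>) <
      card {p \<in> second_parts (n - l) k \<gamma>. adjacent (last p) (\<gamma> ! k)}"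
    using * unfolding all closing r_def[symmetric] by (simp add: field_simps)
qed

section \<open>Halving along the charming indices\<close>

lemma exists_top_subset:
  fixes I :: "'a::linorder set"
  assumes "finite I" "q \<le> card I"
  shows "\<exists>J\<subseteq>I. card J = q \<and> (\<forall>x\<in>I - J. \<forall>y\<in>J. x < y)"
  using assms(2)
proof (induction q)
  case (Suc q)
  then obtain J where J: "J \<subseteq> I" "card J = q" "\<forall>x\<in>I - J. \<forall>y\<in>J. x < y"
    by auto
  have fin: "finite J" "finite (I - J)"
    using J assms(1) finite_subset by auto
  then have "card (I - J) > 0"
    using J Suc.prems by (simp add: card_Diff_subset)
  then have ne: "I - J \<noteq> {}"
    by (simp add: card_gt_0_iff)
  let ?m = "Max (I - J)"
  have m: "?m \<in> I - J"
    using fin ne by (rule_tac Max_in)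
  have "x < ?m" if "x \<in> I - J" "x \<noteq> ?m" for x
    using that fin by (simp add: order.not_eq_order_implies_strict)
  then show ?case
    using m J fin by (intro exI[of _ "insert ?m J"]) auto
qed (auto intro!: exI[of _ "{}"])

text \<open>Over \<open>q\<close> consecutive indices, \<open>\<Sum>j. card (B j)\<close> is at least \<open>q * \<epsilon>\<close> times the
  smallest and at most \<open>D\<close> times the largest of the sets \<open>A j\<close>; hence the cardinality halves.\<close>

lemma iterated_halving:
  fixes A B :: "nat \<Rightarrow> 'b set" and \<epsilon> :: real and D q N :: nat
  assumes fin: "\<And>k. finite (A k)" and anti: "\<And>k k'. k \<le> k' \<Longrightarrow> A k' \<subseteq> A k"
    and N: "\<And>k. card (A k) \<le> N" and q: "2 * real D \<le> real q * \<epsilon>" "0 < D" "0 < q" and "0 \<le> \<epsilon>"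
    and "finite I" "t * q \<le> card I" "\<And>k. k \<in> I \<Longrightarrow> k \<le> l"
    and B: "\<And>k. k \<in> I \<Longrightarrow> B k \<subseteq> A k" "\<And>k. k \<in> I \<Longrightarrow> \<epsilon> * card (A k) \<le> card (B k)"
    and D: "\<And>p. card {k \<in> I. p \<in> B k} \<le> D"
  shows "2 ^ t * card (A l) \<le> N"
  using assms(8-)
proof (induction t arbitrary: I l)
  case 0
  then show ?case
    using N by simp
next
  case (Suc t)
  have "q \<le> card I"
    using Suc.prems(2) by simp
  \<comment> \<open>\<open>J\<close> is the block of the \<open>q\<close> largest indices; the
    induction hypothesis handles the smaller ones, with \<open>Min J\<close> in place of
    \<open>l\<close>.\<close>
  then obtain J where J: "J \<subseteq> I" "card J = q" "\<And>x y. x \<in> I - J \<Longrightarrow> y \<in> J \<Longrightarrow> x < y"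
    using exists_top_subset[OF Suc.prems(1), of q] by blast
  have finJ: "finite J" "J \<noteq> {}"
    using J q Suc.prems(1) finite_subset by auto
  let ?m = "Min J"
  have m: "?m \<in> J"
    using finJ by simp
  have IH: "2 ^ t * card (A ?m) \<le> N"
  proof (rule Suc.IH)
    show "t * q \<le> card (I - J)"
      using Suc.prems J finJ by (simp add: card_Diff_subset)
    show "card {k \<in> I - J. p \<in> B k} \<le> D" for p
      by (rule order_trans[OF card_mono Suc.prems(6)[of p]]) (use Suc.prems(1) in auto)
    show "k \<le> ?m" if "k \<in> I - J" for k
      using J(3)[OF that m] by simp
  qed (use Suc.prems in auto)
  \<comment> \<open>Double counting of the pairs of an index \<open>j\<close> in \<open>J\<close>
    and an element of \<open>B j\<close>, all of which lie in \<open>A ?m\<close>.\<close>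
  have "(\<Sum>p\<in>A ?m. card {j \<in> J. p \<in> B j}) = (\<Sum>j\<in>J. card (B j))"
  proof (rule sum_multicount_gen[OF fin finJ(1)], safe)
    fix j assume "j \<in> J"
    then have "?m \<le> j" "B j \<subseteq> A j"
      using finJ J(1) by (auto intro!: Suc.prems(4))
    then have "B j \<subseteq> A ?m"
      using anti by blast
    then show "card {p \<in> A ?m. p \<in> B j} = card (B j)"
      by (intro arg_cong[of _ _ card]) auto
  qed
  moreover have "(\<Sum>p\<in>A ?m. card {j \<in> J. p \<in> B j}) \<le> (\<Sum>p\<in>A ?m. D)"
  proof (rule sum_mono)
    fix p
    show "card {j \<in> J. p \<in> B j} \<le> D"
      by (rule order_trans[OF card_mono Suc.prems(6)[of p]]) (use J Suc.prems(1) in auto)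
  qed
  ultimately have upper: "(\<Sum>j\<in>J. card (B j)) \<le> D * card (A ?m)"
    by (simp add: mult.commute)
  have "real q * \<epsilon> * card (A l) = (\<Sum>j\<in>J. \<epsilon> * card (A l))"
    by (simp add: J)
  also have "\<dots> \<le> (\<Sum>j\<in>J. real (card (B j)))"
  proof (rule sum_mono)
    fix j assume "j \<in> J"
    then have j: "j \<in> I" "j \<le> l"
      using J Suc.prems(3) by auto
    then have "card (A l) \<le> card (A j)"
      by (intro card_mono fin anti)
    then have "\<epsilon> * card (A l) \<le> \<epsilon> * card (A j)"
      using \<open>0 \<le> \<epsilon>\<close> by (intro mult_left_mono) auto
    then show "\<epsilon> * card (A l) \<le> card (B j)"
      using Suc.prems(5)[OF j(1)] by linarith
  qed
  also have "\<dots> \<le> real D * card (A ?m)"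
    using upper by (simp flip: of_nat_sum of_nat_mult)
  finally have "real q * \<epsilon> * card (A l) \<le> real D * card (A ?m)" .
  \<comment> \<open>The block length \<open>q\<close> is large enough that cancelling
    \<open>D\<close> leaves a factor 2.\<close>
  moreover have "2 * real D * card (A l) \<le> real q * \<epsilon> * card (A l)"
    using q(1) by (intro mult_right_mono) auto
  ultimately have "real D * (2 * card (A l)) \<le> real D * card (A ?m)"
    by simp
  then have "2 * card (A l) \<le> card (A ?m)"
    using q(2) by (simp flip: of_nat_mult)
  then have "2 ^ t * (2 * card (A l)) \<le> 2 ^ t * card (A ?m)"
    by (rule mult_le_mono2)
  also note IH
  finally show ?case
    by (simp add: mult_ac)
qed

text \<open>A longer initial segment leaves more vertices to avoid, and the condition on the first
  step does not involve \<open>k\<close>.\<close>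

lemma second_parts_antimono:
  assumes "\<gamma> \<in> First l" "k \<le> k'"
  shows "second_parts r k' \<gamma> \<subseteq> second_parts r k \<gamma>"
proof
  fix \<phi> assume \<phi>: "\<phi> \<in> second_parts r k' \<gamma>"
  have "set (take (Suc k) \<gamma>) \<subseteq> set (take (Suc k') \<gamma>)"
    using assms by (intro set_take_subset_set_take) simp
  moreover have "0 \<in> set (take (Suc k) \<gamma>)"
    using First_eq_Cons[OF assms(1)] by auto
  ultimately have "set \<phi> \<inter> set (take (Suc k) \<gamma>) = {0}"
    using \<phi> by (auto simp: second_parts_def simp del: take_Suc)
  then show "\<phi> \<in> second_parts r k \<gamma>"
    using \<phi> by (simp add: second_parts_def)
qed

text \<open>The halving argument runs with proportion \<open>real n powr (- \<alpha>)\<close> and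
  multiplicity \<open>2 * d\<close>; the power of 2 comes from the number of complete blocks of
  length \<open>q\<close> among the charming indices.\<close>

lemma card_second_parts_le:
  fixes \<gamma> :: "'d::{finite,linorder} vertex list"
  assumes \<gamma>: "\<gamma> \<in> CS \<alpha> l n \<beta> \<eta>" and "odd n" "l \<le> n" "0 < \<alpha>"
    and large: "real n powr (\<beta> - \<eta> - \<alpha>) \<ge> 20 * (4 * real CARD('d) + 1)"
  shows "2 powr (real n powr (\<beta> - \<eta> - \<alpha>) / (5 * (4 * real CARD('d) + 1))) *
    card (second_parts (n - l) l \<gamma>) \<le> card (First (n - l) :: 'd vertex list set)"
proof -
  define d where "d = CARD('d)"
  define \<delta> where "\<delta> = \<beta> - \<eta> - \<alpha>"
  define A where "A k = second_parts (n - l) k \<gamma>" for k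
  define B where "B k = {p \<in> A k. adjacent (last p) (\<gamma> ! k)}" for k
  define I where "I = {k. real l - real n powr \<beta> \<le> real k \<and> k \<le> l \<and> charming \<alpha> n l \<gamma> k}"
  \<comment> \<open>The least \<open>q\<close> for which \<open>q * real n powr (- \<alpha>)\<close>
    reaches \<open>4 * d\<close>, twice the bound on the number of neighbours.\<close>
  define q where "q = nat \<lceil>4 * real d * real n powr \<alpha>\<rceil>"
  define t where "t = card I div q"
  have d: "0 < d"
    by (simp add: d_def)
  have n: "1 \<le> n"
    using \<open>odd n\<close> by (cases n) auto
  have First: "\<gamma> \<in> First l" and I: "real (card I) \<ge> real n powr (\<beta> - \<eta>) / 4"
    using \<gamma> by (auto simp: CS_def First_in_def I_def)
  have "1 \<le> real n powr \<alpha>"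
    using n \<open>0 < \<alpha>\<close> by (simp add: ge_one_powr_ge_zero)
  then have pos: "0 < 4 * real d * real n powr \<alpha>"
    using d n by simp
  \<comment> \<open>Rounding up adds at most \<open>1 \<le> real n powr \<alpha>\<close>, which
    turns \<open>4 * d\<close> into the \<open>4 * d + 1\<close> of the constants.\<close>
  have q: "4 * real d * real n powr \<alpha> \<le> q" "real q \<le> (4 * real d + 1) * real n powr \<alpha>"
    using pos \<open>1 \<le> real n powr \<alpha>\<close> unfolding q_def by (linarith, simp add: algebra_simps, linarith)
  have q0: "0 < q"
    using pos q(1) by linarith
  have len: "length \<gamma> = Suc l" "distinct \<gamma>"
    using First by (auto simp: First_iff self_avoiding_walk_iff)
  have "2 ^ t * card (A l) \<le> card (First (n - l) :: 'd vertex list set)"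
  proof (rule iterated_halving[where A = A and B = B and I = I and D = "2 * d" and q = q and \<epsilon> = "real n powr (- \<alpha>)"])
    show "finite (A k)" for k
      by (simp add: A_def finite_second_parts)
    show "A k' \<subseteq> A k" if "k \<le> k'" for k k'
      unfolding A_def by (rule second_parts_antimono[OF First that])
    show "card (A k) \<le> card (First (n - l) :: 'd vertex list set)" for k
      by (rule card_mono[OF finite_First]) (auto simp: A_def second_parts_def)
    have "4 * real d = 4 * real d * real n powr \<alpha> * real n powr (- \<alpha>)"
      using n by (simp add: powr_minus field_simps)
    also have "\<dots> \<le> real q * real n powr (- \<alpha>)"
      using q(1) by (intro mult_right_mono) auto
    finally show "2 * real (2 * d) \<le> real q * real n powr (- \<alpha>)"
      by simp
    show "finite I"
      by (rule finite_subset[of _ "{..l}"]) (auto simp: I_def)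
    show "t * q \<le> card I"
      by (simp add: t_def)
    show "k \<le> l" "B k \<subseteq> A k" "real n powr (- \<alpha>) * card (A k) \<le> card (B k)" if "k \<in> I" for k
      using that charming_card(2)[OF _ First assms(2,3), of \<alpha> k] by (auto simp: I_def A_def B_def)
    show "card {k \<in> I. p \<in> B k} \<le> 2 * d" for p
    proof -
      \<comment> \<open>A self-avoiding \<open>\<gamma>\<close> visits each neighbour of the
        endpoint of \<open>p\<close> at most once.\<close>
      have "card {k \<in> I. p \<in> B k} \<le> card {v. adjacent (last p) v}"
      proof (rule card_inj_on_le)
        show "inj_on ((!) \<gamma>) {k \<in> I. p \<in> B k}"
          using len by (intro inj_onI) (auto simp: I_def nth_eq_iff_index_eq)
        show "(!) \<gamma> ` {k \<in> I. p \<in> B k} \<subseteq> {v. adjacent (last p) v}"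
          by (auto simp: B_def)
      qed simp
      also have "\<dots> \<le> 2 * d"
        unfolding d_def by (rule card_neighbours_le)
      finally show ?thesis .
    qed
  qed (use d q0 in auto)
  then have "real (2 ^ t * card (A l)) \<le> real (card (First (n - l) :: 'd vertex list set))"
    by (simp only: of_nat_le_iff)
  then have t: "2 powr real t * card (A l) \<le> card (First (n - l) :: 'd vertex list set)"
    by (simp add: powr_realpow)
  have "real n powr (\<beta> - \<eta>) = real n powr \<delta> * real n powr \<alpha>"
    by (simp add: \<delta>_def flip: powr_add)
  then have "real n powr \<delta> * real n powr \<alpha> / 4 \<le> card I"
    using I by simp
  moreover have "x / (4 * y) * (y * z) = x * z / 4" if "0 < y" for x y z :: real
    using that by simp
  then have "real n powr \<delta> / (4 * (4 * real d + 1)) * ((4 * real d + 1) * real n powr \<alpha>) =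
      real n powr \<delta> * real n powr \<alpha> / 4"
    by this simp
  ultimately have "real n powr \<delta> / (4 * (4 * real d + 1)) * ((4 * real d + 1) * real n powr \<alpha>) \<le> card I"
    by linarith
  moreover have "real n powr \<delta> / (4 * (4 * real d + 1)) * real q \<le>
      real n powr \<delta> / (4 * (4 * real d + 1)) * ((4 * real d + 1) * real n powr \<alpha>)"
    using q(2) by (intro mult_left_mono) auto
  ultimately have "real n powr \<delta> / (4 * (4 * real d + 1)) * real q \<le> card I"
    by linarith
  then have "real n powr \<delta> / (4 * (4 * real d + 1)) \<le> card I / q"
    using q0 by (simp only: pos_le_divide_eq of_nat_0_less_iff)
  also have "\<dots> \<le> real t + 1"
  proof -
    have "card I < q + t * q"
      unfolding t_def using q0 by (rule dividend_less_div_times)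
    then have "real (card I) \<le> (real t + 1) * real q"
      by (simp add: algebra_simps flip: of_nat_mult of_nat_add)
    then show ?thesis
      using q0 by (simp add: pos_divide_le_eq)
  qed
  finally have "real n powr \<delta> / (4 * (4 * real d + 1)) - 1 \<le> t"
    by simp
  \<comment> \<open>The discarded incomplete block costs 1. As \<open>1/4 - 1/5 = 1/20\<close>, the
    threshold 20 lets the replacement of 4 by 5 absorb it.\<close>
  moreover have "x / (5 * y) \<le> x / (4 * y) - 1" if "20 * y \<le> x" "0 < y" for x y :: real
    using that by (simp add: field_simps)
  then have "real n powr \<delta> / (5 * (4 * real d + 1)) \<le> real n powr \<delta> / (4 * (4 * real d + 1)) - 1"
    using large by (simp only: \<delta>_def d_def)
  ultimately have "2 powr (real n powr \<delta> / (5 * (4 * real d + 1))) \<le> 2 powr real t"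
    by (intro powr_mono) auto
  then have "2 powr (real n powr \<delta> / (5 * (4 * real d + 1))) * card (A l) \<le> 2 powr real t * card (A l)"
    by (intro mult_right_mono) auto
  also note t
  finally show ?thesis
    by (simp add: A_def \<delta>_def d_def)
qed

section \<open>The bound on the closing probability\<close>

theorem theorem3p2:
  fixes d n l :: nat and c K \<alpha> \<beta> \<eta> \<delta> :: real
  assumes "d = CARD('d::{finite,linorder})" and "d \<ge> 2"
    and "c = 2 powr (1 / (5 * (4 * real d + 1)))"
    and "K = 20 * (4 * real d + 1) * (ln (4 * real d) / ln 2)"
    and "\<alpha> > 0" and "0 < \<beta>" and "\<beta> \<le> 1" and "0 < \<eta>" and "\<eta> < \<beta>"
    and "\<delta> = \<beta> - \<eta> - \<alpha>" and "\<delta> > 0"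
    and "odd n" and "l \<le> n"
    and "real n \<ge> K powr (1 / \<delta>)"
    and "measure_pmf.prob (Pol (n + 1) :: 'd vertex set set pmf)
           {P. take (Suc l) (tour (n + 1) P) \<in> CS \<alpha> l n \<beta> \<eta>}
         \<ge> c powr (- (real n powr \<delta>) / 2)"
  shows "measure_pmf.prob (W n :: 'd vertex list pmf) {\<Gamma>. closes \<Gamma>}
         \<le> 2 * (real n + 1) * c powr (- (real n powr \<delta>) / 2)"
proof -
  let ?SAP = "SAP (Suc n) :: 'd vertex set set set"
  let ?SAW = "SAW n :: 'd vertex list set"
  let ?CS = "CS \<alpha> l n \<beta> \<eta> :: 'd vertex list set"
  let ?Q = "{P \<in> ?SAP. take (Suc l) (tour (Suc n) P) \<in> ?CS}"
  \<comment> \<open>\<open>X * X\<close> is the gain from \<open>card_second_parts_le\<close>; the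
    hypothesis on polygons costs one factor \<open>X\<close>, and the other survives in the
    bound.\<close>
  define X where "X = c powr (real n powr \<delta> / 2)"
  have "0 < c"
    by (simp add: assms(3))
  then have X: "X > 0" "c powr (- (real n powr \<delta>) / 2) = 1 / X"
    by (simp_all add: X_def powr_minus field_simps)
  have half: "1 / a * (x / 2) + 1 / a * (x / 2) = x / a" for a x :: real
    by (simp flip: add_divide_distrib)
  have XX: "2 powr (real n powr \<delta> / (5 * (4 * real d + 1))) = X * X"
    by (simp only: X_def assms(3) powr_powr powr_add[symmetric] half)
  \<comment> \<open>Since \<open>4 * d \<ge> 2\<close>, \<open>K\<close> reaches the threshold of
    \<open>card_second_parts_le\<close>. It also exceeds 1, so the odd number \<open>n\<close> is at
    least 3 and \<open>n + 1\<close> is an admissible polygon length.\<close>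
  have "1 \<le> ln (4 * real d) / ln 2"
    using assms(2) by simp
  then have K: "20 * (4 * real d + 1) \<le> K"
    unfolding assms(4) using mult_left_mono[of 1 _ "20 * (4 * real d + 1)"] by fastforce
  then have "1 < K"
    by simp
  then have "1 < K powr (1 / \<delta>)"
    using \<open>\<delta> > 0\<close> by simp
  then have "1 < n"
    using assms(14) by linarith
  then have n: "3 \<le> n"
    using \<open>odd n\<close> by (cases "n = 2") auto
  have "K = (K powr (1 / \<delta>)) powr \<delta>"
    using \<open>1 < K\<close> \<open>\<delta> > 0\<close> by (simp add: powr_powr)
  also have "\<dots> \<le> real n powr \<delta>"
    using assms(14) \<open>\<delta> > 0\<close> by (intro powr_mono2) auto
  finally have large: "20 * (4 * real d + 1) \<le> real n powr \<delta>"
    using K by simp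
  have closing: "card {\<gamma> \<in> ?SAW. closes \<gamma>} \<le> 2 * (n + 1) * card ?SAP"
    by (rule card_closing_le[OF \<open>odd n\<close> n])
  have fin_SAP: "finite ?SAP"
    by (rule finite_SAP[OF \<open>odd n\<close> n])
  have SAW_pos: "card ?SAW > 0"
    by (simp add: card_gt_0_iff finite_SAW SAW_nonempty)
  have "X * card ?SAP \<le> card ?SAW"
  \<comment> \<open>Without polygons the left side is 0; \<open>Pol\<close> is a genuine uniform law
    only in the other case.\<close>
  proof (cases "?SAP = {}")
    case False
    have SAP_pos: "card ?SAP > 0"
      using False fin_SAP by (simp add: card_gt_0_iff)
    have "measure_pmf.prob (Pol (Suc n) :: 'd vertex set set pmf) {P. take (Suc l) (tour (Suc n) P) \<in> ?CS} = card ?Q / card ?SAP"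
      using False fin_SAP by (simp add: Pol_def measure_pmf_of_set Int_def)
    then have Q: "1 / X \<le> card ?Q / card ?SAP"
      using assms(15) X(2) by simp
    then have Q': "card ?SAP \<le> X * card ?Q"
      using X(1) SAP_pos by (simp add: field_simps)
    \<comment> \<open>Positive probability yields a member of \<open>?CS\<close>. It has a charming
      index, which is at least 1, so \<open>1 \<le> l\<close> as the cutting of tours
      requires.\<close>
    have "?Q \<noteq> {}"
      using Q' SAP_pos by (metis card.empty mult_zero_right not_le of_nat_0 of_nat_0_less_iff)
    then obtain \<gamma> where \<gamma>: "\<gamma> \<in> ?CS"
      by blast
    then have "0 < card {k. real l - real n powr \<beta> \<le> real k \<and> k \<le> l \<and> charming \<alpha> n l \<gamma> k}"
      using n powr_gt_zero[of "real n" "\<beta> - \<eta>"] unfolding CS_def by (intro gr0I) auto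
    then have "{k. real l - real n powr \<beta> \<le> real k \<and> k \<le> l \<and> charming \<alpha> n l \<gamma> k} \<noteq> {}"
      by (metis card.empty less_irrefl)
    then obtain k where k: "k \<le> l" "charming \<alpha> n l \<gamma> k"
      by blast
    have "\<gamma> \<in> First l"
      using \<gamma> by (simp add: CS_def First_in_def)
    then have l: "1 \<le> l"
      using charming_card(1)[OF k(2) _ \<open>odd n\<close> \<open>l \<le> n\<close>] k(1) by simp
    have CS_First: "?CS \<subseteq> First l"
      by (auto simp: CS_def First_in_def)
    then have fin: "finite ?CS"
      using finite_First finite_subset by blast
    have "card ?Q \<le> (\<Sum>\<gamma>\<in>?CS. card (second_parts (n - l) l \<gamma>))"
      by (rule card_SAP_first_le[OF \<open>odd n\<close> n l \<open>l \<le> n\<close> fin])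
    then have "real (card ?Q) \<le> real (\<Sum>\<gamma>\<in>?CS. card (second_parts (n - l) l \<gamma>))"
      by (rule of_nat_mono)
    then have "X * X * card ?Q \<le> X * X * (\<Sum>\<gamma>\<in>?CS. card (second_parts (n - l) l \<gamma>))"
      by (rule mult_left_mono) simp
    also have "\<dots> = (\<Sum>\<gamma>\<in>?CS. X * X * card (second_parts (n - l) l \<gamma>))"
      by (simp add: sum_distrib_left)
    also have "\<dots> \<le> (\<Sum>\<gamma>\<in>?CS. real (card (First (n - l) :: 'd vertex list set)))"
    proof (rule sum_mono)
      fix \<gamma> assume "\<gamma> \<in> ?CS"
      then show "X * X * card (second_parts (n - l) l \<gamma>) \<le> card (First (n - l) :: 'd vertex list set)"
        using card_second_parts_le[of \<gamma> \<alpha> l n \<beta> \<eta>] large XX assms(1,5,10,12,13) by simp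
    qed
    also have "\<dots> = real (card ?CS * card (First (n - l) :: 'd vertex list set))"
      by simp
    also have "\<dots> \<le> real (card (First l :: 'd vertex list set) * card (First (n - l) :: 'd vertex list set))"
      using card_mono[OF finite_First CS_First] by (intro of_nat_mono mult_right_mono) auto
    also have "\<dots> \<le> card ?SAW"
      using card_First_mult_le[OF \<open>l \<le> n\<close>] by (intro of_nat_mono)
    finally have "X * (X * card ?Q) \<le> card ?SAW"
      by (simp add: mult.assoc)
    moreover have "X * card ?SAP \<le> X * (X * card ?Q)"
      using Q' X(1) by (intro mult_left_mono) auto
    ultimately show ?thesis
      by linarith
  qed simp
  then have ratio: "card ?SAP / card ?SAW \<le> 1 / X"
    using X(1) SAW_pos by (simp add: field_simps)
  have "measure_pmf.prob (W n :: 'd vertex list pmf) {\<Gamma>. closes \<Gamma>} =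
      card {\<gamma> \<in> ?SAW. closes \<gamma>} / card ?SAW"
    by (simp add: W_def measure_pmf_of_set finite_SAW SAW_nonempty Int_def)
  also have "\<dots> \<le> real (2 * (n + 1) * card ?SAP) / card ?SAW"
    using closing by (intro divide_right_mono of_nat_mono) auto
  also have "\<dots> = 2 * (real n + 1) * (card ?SAP / card ?SAW)"
    by (simp add: algebra_simps)
  also have "\<dots> \<le> 2 * (real n + 1) * (1 / X)"
    using ratio by (intro mult_left_mono) auto
  finally show ?thesis
    using X(2) by simp
qed

end
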